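(* Every near-alternating link is almost alternating.
   Context: A link diagram is almost alternating if one crossing change makes the diagram alternating; a link is almost alternating if it admits an almost alternating diagram. **Resolutions and adequacy.** At a crossing of a link diagram $D$, the $+$-resolution is the smoothing that joins the two regions swept out when the overstrand is rotated counterclockwise; the $-$-resolution is the other smoothing. Applying the $+$-resolution (resp. $-$-resolution) at every crossing gives disjoint state circles, with one segment recording each former crossing; the state graph $s_+(D)$ (resp. $s_-(D)$) has the state circles as vertices and the segments as edges. A diagram is $+$-adequate (resp. $-$-adequate) if $s_+(D)$ (resp. $s_-(D)$) has no one-edged loops, and adequate if it is both. **Diagrams from weighted graphs.** Let $G$ be a finite planar graph in $S^2$ (multiple edges allowed) with an edge weight $\omega_e\in\mathbb Z\setminus\{0\}$ for each edge $e$. $F_G$ is the surface obtained by replacing each vertex by a disk and each edge $e$ by a band with $|\omega_e|$ half twists, and $\partial(F_G)$ is the resulting link diagram. Sign convention: if $\omega_e>0$ (resp. $\omega_e<0$) the half twists are such that the $+$-resolution (resp. $-$-resolution) at each crossing of the band cuts the band transversely, separating its two ends. A path in $G$ is a finite sequence of distinct vertices, consecutive ones joined by an edge of the path (paths using different parallel edges are different). The length of a path $W$ whose edges have weights $\omega_1,\dots,\omega_{k-1}$ is $\ell(W)=2+\sum_{i=1}^{k-1}(|\omega_i|-2)$. A graph is 2-connected if it has no vertex whose removal disconnects it. **Prime and twist-reduced.** A diagram is prime if every simple closed curve on the projection sphere meeting it transversely in two non-crossing points bounds, on one side, a part of the diagram with no crossings. It is twist-reduced if whenever a simple closed curve meets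 it transversely in four points, two adjacent to one crossing and two adjacent to another crossing, the curve bounds a subdiagram consisting of a (possibly empty) row of bigons strung end to end between these two crossings. **Near-alternating.** A non-split link diagram $D=\partial(F_G)$ is near-alternating if $G$ is a 2-connected finite weighted planar graph without one-edged loops, with exactly one negatively weighted edge $e=(v,v')$, of weight $r<0$, $|r|\ge 2$, such that: (1) if $\omega$ is the minimum of $\ell(W)$ over all paths $W$ in $G\setminus e$ ($e$ deleted) from $v$ to $v'$ and $t$ is the number of such paths, then $t>2$ and $\omega/t>|r|$; (2) $G\setminus e$ is 2-connected, the diagram $\partial(F_{G\setminus e})$ is prime and twist-reduced, and the diagram $\partial(F_{G/e})$ ($e$ contracted) is adequate. A link is near-alternating if it admits a near-alternating diagram. *)

theory Defs
  imports
    Complex_Main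
    "HOL-Combinatorics.Permutations"
    "HOL-Combinatorics.Orbits"
    "Graph_Theory.Graph_Theory"
begin

section \<open>Link diagrams on the sphere\<close>

text \<open>
  Diagrams are given by (unoriented) planar diagram codes.  The arcs of the diagram, that is the
  edges of the underlying 4-valent graph, carry labels.  In \<open>Xing a b c d\<close> the four arcs at a
  crossing are listed counterclockwise, with \<open>a\<close>, \<open>c\<close> on the understrand and \<open>b\<close>, \<open>d\<close> on the
  overstrand; so \<open>Xing a b c d\<close> and \<open>Xing c d a b\<close> describe the same crossing.  The field
  \<open>circles\<close> counts the components without crossings.

  The position of the connected components of a diagram relative to each other is not recorded: it
  does not affect the link, because a split component can be moved into any region.
\<close>

datatype 'a crossing = Xing 'a 'a 'a 'a

record 'a diagram =
  crossings :: "'a crossing set"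
  circles :: nat

fun arc_at :: "'a crossing \<Rightarrow> nat \<Rightarrow> 'a" where
  "arc_at (Xing a b c d) i = [a, b, c, d] ! i"

fun half_turn :: "'a crossing \<Rightarrow> 'a crossing" where
  "half_turn (Xing a b c d) = Xing c d a b"

fun change :: "'a crossing \<Rightarrow> 'a crossing" where
  "change (Xing a b c d) = Xing b c d a"

definition labels :: "'a crossing set \<Rightarrow> 'a set" where
  "labels K = (\<Union>x\<in>K. set_crossing x)"

text \<open>An end \<open>(x, i)\<close> is the \<open>i\<close>-th half-arc, \<open>i < 4\<close>, at the crossing \<open>x\<close>.\<close>

definition ends :: "'a diagram \<Rightarrow> ('a crossing \<times> nat) set" where
  "ends D = crossings D \<times> {..<4}"

definition arc_of :: "'a crossing \<times> nat \<Rightarrow> 'a" where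
  "arc_of h = arc_at (fst h) (snd h)"

definition other_end :: "'a diagram \<Rightarrow> 'a crossing \<times> nat \<Rightarrow> 'a crossing \<times> nat" where
  "other_end D h = (THE h'. h' \<in> ends D \<and> h' \<noteq> h \<and> arc_of h' = arc_of h)"

text \<open>
  Walk along the arc of an end away from its crossing, and at the next crossing turn onto the next
  arc in clockwise order.  This follows the boundary of the region on the left, so the regions of
  a connected diagram are the orbits; the end \<open>(x, i)\<close> lies in the orbit of the region with the
  corner between the \<open>i\<close>-th and the \<open>(i+1)\<close>-st half-arc at \<open>x\<close>.
\<close>

definition region_step :: "'a diagram \<Rightarrow> 'a crossing \<times> nat \<Rightarrow> 'a crossing \<times> nat" where
  "region_step D h = (let h' = other_end D h in (fst h', (snd h' + 3) mod 4))"

definition regions :: "'a diagram \<Rightarrow> ('a crossing \<times> nat) set set" where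
  "regions D = orbit (region_step D) ` ends D"

definition adjacent :: "'a diagram \<Rightarrow> ('a crossing \<times> 'a crossing) set" where
  "adjacent D = {(x, y). x \<in> crossings D \<and> y \<in> crossings D \<and> set_crossing x \<inter> set_crossing y \<noteq> {}}"

definition components :: "'a diagram \<Rightarrow> 'a crossing set set" where
  "components D = crossings D // (adjacent D)\<^sup>+"

text \<open>
  Planarity: the Euler characteristic (vertices minus edges plus faces) of every connected
  component is at most 2, with equality exactly when it is drawn on a sphere; hence all components
  are spherical iff the sum is twice the number of components.
\<close>

definition link_diagram :: "'a diagram \<Rightarrow> bool" where
  "link_diagram D \<longleftrightarrow>
     finite (crossings D) \<and>
     (\<forall>a\<in>labels (crossings D). card {h \<in> ends D. arc_of h = a} = 2) \<and>
     int (card (crossings D)) - int (card (labels (crossings D))) + int (card (regions D))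
       = 2 * int (card (components D))"

definition non_split :: "'a diagram \<Rightarrow> bool" where
  "non_split D \<longleftrightarrow> card (components D) + circles D = 1"

definition diagram_iso :: "'a diagram \<Rightarrow> 'b diagram \<Rightarrow> bool" where
  "diagram_iso D D' \<longleftrightarrow> circles D = circles D' \<and>
     (\<exists>f g. inj_on f (labels (crossings D)) \<and> bij_betw g (crossings D) (crossings D') \<and>
        (\<forall>x\<in>crossings D. g x = map_crossing f x \<or> g x = half_turn (map_crossing f x)))"


section \<open>Alternating and almost alternating diagrams\<close>

definition alternating :: "'a diagram \<Rightarrow> bool" where
  "alternating D \<longleftrightarrow> (\<forall>h\<in>ends D. odd (snd h) \<longleftrightarrow> even (snd (other_end D h)))"

definition crossing_change :: "'a crossing \<Rightarrow> 'a diagram \<Rightarrow> 'a diagram" where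
  "crossing_change x D = D\<lparr>crossings := insert (change x) (crossings D - {x})\<rparr>"

definition almost_alternating :: "'a diagram \<Rightarrow> bool" where
  "almost_alternating D \<longleftrightarrow> link_diagram D \<and> (\<exists>x\<in>crossings D. alternating (crossing_change x D))"


section \<open>Links\<close>

text \<open>
  \<open>join ps D\<close> splices, for each \<open>(a, b)\<close> in \<open>ps\<close>, the loose end of the arc \<open>a\<close> to the loose end of
  the arc \<open>b\<close>; if these are the two ends of one strand, a circle without crossings arises.
\<close>

fun join :: "('a \<times> 'a) list \<Rightarrow> 'a diagram \<Rightarrow> 'a diagram" where
  "join [] D = D"
| "join ((a, b) # ps) D =
     (if a = b then join ps (D\<lparr>circles := Suc (circles D)\<rparr>)
      else let f = id(a := b) in
        join (map (map_prod f f) ps) \<lparr>crossings = map_crossing f ` crossings D, circles = circles D\<rparr>)"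

text \<open>
  In each move \<open>K\<close> is the part of the diagram outside the disk where the move takes place.  The arcs
  inside the disk are \<open>a\<close>; \<open>u\<close>, \<open>v\<close>; or \<open>t\<close>, \<open>m\<close>, \<open>b\<close>, and all other arcs leave the disk.

  In the third move the disk contains three strands, with counterclockwise boundary points
  \<open>t1\<close>, \<open>m1\<close>, \<open>b1\<close>, \<open>t2\<close>, \<open>m2\<close>, \<open>b2\<close>; in \<open>R3\<close> the strand from \<open>t1\<close> to \<open>t2\<close> is above the one from
  \<open>m1\<close> to \<open>m2\<close>, which is above the one from \<open>b1\<close> to \<open>b2\<close>; in \<open>R3'\<close> these heights are reversed.
\<close>

inductive reidemeister :: "'a diagram \<Rightarrow> 'a diagram \<Rightarrow> bool" where
  R1: "\<lbrakk>a \<notin> labels K; a \<notin> {b, c}\<rbrakk> \<Longrightarrow>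
    reidemeister \<lparr>crossings = insert (Xing a a b c) K, circles = n\<rparr>
      (join [(b, c)] \<lparr>crossings = K, circles = n\<rparr>)"
| R1': "\<lbrakk>a \<notin> labels K; a \<notin> {b, c}\<rbrakk> \<Longrightarrow>
    reidemeister \<lparr>crossings = insert (Xing b a a c) K, circles = n\<rparr>
      (join [(b, c)] \<lparr>crossings = K, circles = n\<rparr>)"
| R2: "\<lbrakk>u \<noteq> v; {u, v} \<inter> labels K = {}; {u, v} \<inter> {u1, u2, v1, v2} = {}\<rbrakk> \<Longrightarrow>
    reidemeister \<lparr>crossings = {Xing u1 v1 u v, Xing u v2 u2 v} \<union> K, circles = n\<rparr>
      (join [(u1, u2), (v1, v2)] \<lparr>crossings = K, circles = n\<rparr>)"
| R3: "\<lbrakk>distinct [t, m, b]; {t, m, b} \<inter> labels K = {}; {t, m, b} \<inter> {t1, m1, b1, t2, m2, b2} = {}\<rbrakk> \<Longrightarrow>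
    reidemeister
      \<lparr>crossings = {Xing m1 t m t1, Xing b1 t2 b t, Xing b m2 b2 m} \<union> K, circles = n\<rparr>
      \<lparr>crossings = {Xing m t2 m2 t, Xing b t b2 t1, Xing b1 m b m1} \<union> K, circles = n\<rparr>"
| R3': "\<lbrakk>distinct [t, m, b]; {t, m, b} \<inter> labels K = {}; {t, m, b} \<inter> {t1, m1, b1, t2, m2, b2} = {}\<rbrakk> \<Longrightarrow>
    reidemeister
      \<lparr>crossings = {Xing t m t1 m1, Xing t2 b t b1, Xing m2 b2 m b} \<union> K, circles = n\<rparr>
      \<lparr>crossings = {Xing t2 m2 t m, Xing t b2 t1 b, Xing m b m1 b1} \<union> K, circles = n\<rparr>"

text \<open>
  A link is the class of all its diagrams.  Both sides of every step are planar; this is what forces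
  the two strands in a second move that creates crossings to border a common region (or to belong
  to different components of the diagram).
\<close>

definition diagram_step :: "'a diagram \<Rightarrow> 'a diagram \<Rightarrow> bool" where
  "diagram_step D D' \<longleftrightarrow> link_diagram D \<and> link_diagram D' \<and> (diagram_iso D D' \<or> reidemeister D D')"

definition same_link :: "(nat diagram \<times> nat diagram) set" where
  "same_link = {(D, D'). equivclp diagram_step D D'}"

definition links :: "nat diagram set set" where
  "links = {D. link_diagram D} // same_link"

definition almost_alternating_link :: "nat diagram set \<Rightarrow> bool" where
  "almost_alternating_link L \<longleftrightarrow> L \<in> links \<and> (\<exists>D\<in>L. almost_alternating D)"


section \<open>State graphs and adequacy\<close>

datatype resolution = Plus | Minus

text \<open>
  Rotating the overstrand of \<open>Xing a b c d\<close> counterclockwise sweeps the corners between \<open>b\<close>, \<open>c\<close>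
  and between \<open>d\<close>, \<open>a\<close>; joining these two regions connects \<open>a\<close> with \<open>b\<close> and \<open>c\<close> with \<open>d\<close>.
\<close>

fun smoothing :: "resolution \<Rightarrow> 'a crossing \<Rightarrow> ('a \<times> 'a) set" where
  "smoothing Plus (Xing a b c d) = {(a, b), (c, d)}"
| "smoothing Minus (Xing a b c d) = {(b, c), (d, a)}"

text \<open>A state circle is represented by the set of the arcs of the diagram it runs through.\<close>

definition state_circle :: "resolution \<Rightarrow> 'a diagram \<Rightarrow> 'a \<Rightarrow> 'a set" where
  "state_circle s D a =
     (let R = (\<Union>x\<in>crossings D. smoothing s x) in (R \<union> R\<inverse>)\<^sup>* `` {a})"

text \<open>
  The direction of the edges has no meaning.  With either resolution the arcs at positions 0 and 2
  lie on different sides of the segment recording the crossing.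
\<close>

definition state_graph :: "resolution \<Rightarrow> 'a diagram \<Rightarrow> ('a set + nat, 'a crossing) pre_digraph" where
  "state_graph s D =
     \<lparr>verts = Inl ` state_circle s D ` labels (crossings D) \<union> Inr ` {..<circles D},
      arcs = crossings D,
      tail = (\<lambda>x. Inl (state_circle s D (arc_at x 0))),
      head = (\<lambda>x. Inl (state_circle s D (arc_at x 2)))\<rparr>"

definition adequate_for :: "resolution \<Rightarrow> 'a diagram \<Rightarrow> bool" where
  "adequate_for s D \<longleftrightarrow> loopfree_digraph (state_graph s D)"

definition adequate :: "'a diagram \<Rightarrow> bool" where
  "adequate D \<longleftrightarrow> adequate_for Plus D \<and> adequate_for Minus D"


section \<open>Prime and twist-reduced diagrams\<close>

text \<open>
  A simple closed curve transverse to the diagram is recorded by the set \<open>S\<close> of crossings on one of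
  its sides.  The arcs it has to meet are those in \<open>cut D S\<close>; if it meets an arc \<open>n\<close> times, the arc
  is in \<open>cut D S\<close> iff \<open>n\<close> is odd.
\<close>

definition cut :: "'a diagram \<Rightarrow> 'a crossing set \<Rightarrow> 'a set" where
  "cut D S = labels S \<inter> labels (crossings D - S)"

text \<open>
  A curve meeting the diagram in two points meets two different arcs, or one arc twice; in the
  latter case the cut is empty.
\<close>

definition prime_diagram :: "'a diagram \<Rightarrow> bool" where
  "prime_diagram D \<longleftrightarrow>
     (\<forall>S\<subseteq>crossings D. card (cut D S) \<le> 2 \<longrightarrow> S = {} \<or> crossings D - S = {})"

text \<open>A region is named by a corner \<open>(x, i)\<close>; \<open>bigon D h h'\<close> says that \<open>h\<close>, \<open>h'\<close> are the two
  corners of one bigon.\<close>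

definition bigon :: "'a diagram \<Rightarrow> 'a crossing \<times> nat \<Rightarrow> 'a crossing \<times> nat \<Rightarrow> bool" where
  "bigon D h h' \<longleftrightarrow> h \<in> ends D \<and> h' \<in> ends D \<and> fst h \<noteq> fst h' \<and>
     region_step D h = h' \<and> region_step D h' = h"

definition opposite_corner :: "'a crossing \<times> nat \<Rightarrow> 'a crossing \<times> nat" where
  "opposite_corner h = (fst h, (snd h + 2) mod 4)"

text \<open>
  A row of bigons from the first to the last crossing of a list: consecutive crossings span a
  bigon, and consecutive bigons meet in opposite corners of their common crossing.
\<close>

definition bigon_row :: "'a diagram \<Rightarrow> 'a crossing list \<Rightarrow> bool" where
  "bigon_row D xs \<longleftrightarrow> distinct xs \<and> set xs \<subseteq> crossings D \<and>
     (\<exists>c. \<forall>i. Suc i < length xs \<longrightarrow>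
        bigon D (xs ! i, c i) (opposite_corner (xs ! Suc i, c (Suc i))))"

text \<open>
  The curve meets four different arcs, the two in \<open>P\<close> next to the crossing \<open>x\<close> and the two in \<open>Q\<close>
  next to the crossing \<open>y\<close>.  Each of \<open>x\<close> and \<open>y\<close> may be on either side of the curve, so the
  crossings of the bounded side are those of the row up to \<open>x\<close> and \<open>y\<close>.

  Curves meeting an arc twice need no consideration in a prime diagram: four points on fewer than four
  arcs give a cut of size at most 2, so all crossings are on one side, and the conclusion holds.
\<close>

definition twist_reduced :: "'a diagram \<Rightarrow> bool" where
  "twist_reduced D \<longleftrightarrow>
     (\<forall>S x y P Q. S \<subseteq> crossings D \<and> x \<in> crossings D \<and> y \<in> crossings D \<and> x \<noteq> y \<and>
        cut D S = P \<union> Q \<and> P \<inter> Q = {} \<and> card P = 2 \<and> card Q = 2 \<and>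
        P \<subseteq> set_crossing x \<and> Q \<subseteq> set_crossing y \<longrightarrow>
        (\<exists>T\<in>{S, crossings D - S}. \<exists>xs. xs \<noteq> [] \<and> hd xs = x \<and> last xs = y \<and>
           bigon_row D xs \<and> set xs = T \<union> {x, y}))"


section \<open>Weighted plane graphs and their diagrams\<close>

text \<open>
  A graph embedded in the oriented sphere is given by its rotation system.  A dart \<open>(e, o)\<close> is the
  edge \<open>e\<close> with one of its two orientations; \<open>rot\<close> maps a dart to the next one, counterclockwise,
  among the darts leaving the same vertex.  Vertices are the orbits of \<open>rot\<close>; thus there are no
  isolated vertices, as in every connected graph with an edge.
\<close>

record 'e plane_graph =
  edges :: "'e set"
  rot :: "'e \<times> bool \<Rightarrow> 'e \<times> bool"
  weight :: "'e \<Rightarrow> int"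

definition darts :: "'e plane_graph \<Rightarrow> ('e \<times> bool) set" where
  "darts G = edges G \<times> UNIV"

definition rev_dart :: "'e \<times> bool \<Rightarrow> 'e \<times> bool" where
  "rev_dart d = (fst d, \<not> snd d)"

definition underlying :: "'e plane_graph \<Rightarrow> (('e \<times> bool) set, 'e \<times> bool) pre_digraph" where
  "underlying G =
     \<lparr>verts = orbit (rot G) ` darts G,
      arcs = darts G,
      tail = orbit (rot G),
      head = (\<lambda>d. orbit (rot G) (rev_dart d))\<rparr>"

definition faces :: "'e plane_graph \<Rightarrow> ('e \<times> bool) set set" where
  "faces G = orbit (rot G \<circ> rev_dart) ` darts G"

definition connected_plane_graph :: "'e plane_graph \<Rightarrow> bool" where
  "connected_plane_graph G \<longleftrightarrow>
     finite (edges G) \<and> rot G permutes darts G \<and> Digraph_Component.connected (underlying G) \<and>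
     int (card (verts (underlying G))) - int (card (edges G)) + int (card (faces G)) = 2"

definition two_connected :: "('v, 'd) pre_digraph \<Rightarrow> bool" where
  "two_connected H \<longleftrightarrow> Digraph_Component.connected H \<and>
     (\<forall>v\<in>verts H. verts H \<noteq> {v} \<longrightarrow> Digraph_Component.connected (pre_digraph.del_vert H v))"

text \<open>
  The boundary of the surface.  Let \<open>d\<close> be a dart of an edge of weight \<open>w\<close>; number the \<open>\<bar>w\<bar>\<close>
  crossings of the band from 0, starting at the tail of \<open>d\<close>.  The label \<open>(d, k)\<close> stands for the arc
  on the right of the band, seen in the direction of \<open>d\<close>, that precedes crossing \<open>k\<close>; every arc is
  \<open>(d, k)\<close> for exactly one dart \<open>d\<close> and \<open>k < \<bar>w\<bar>\<close>.  The arc on the left of the band preceding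
  crossing 0 runs along the boundary of the disk to the right side of the next band, and for
  \<open>k > 0\<close> the left side preceding crossing \<open>k\<close> is a right side with respect to the reversed dart,
  for which that crossing has number \<open>\<bar>w\<bar> - 1 - k\<close>.

  In \<open>band_crossing\<close> the near arcs \<open>nl\<close>, \<open>nr\<close> and the far arcs \<open>fr\<close>, \<open>fl\<close> are in
  counterclockwise order \<open>nl, nr, fr, fl\<close>.  Cutting the band transversely connects \<open>nl\<close> with \<open>nr\<close>
  and \<open>fl\<close> with \<open>fr\<close>, which is the Plus resolution in the first case and the Minus resolution in the
  second.
\<close>

definition left_arc :: "'e plane_graph \<Rightarrow> 'e \<times> bool \<Rightarrow> nat \<Rightarrow> ('e \<times> bool) \<times> nat" where
  "left_arc G d k =
     (if k = 0 then (rot G d, 0) else (rev_dart d, nat \<bar>weight G (fst d)\<bar> - k))"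

definition band_crossing :: "'e plane_graph \<Rightarrow> 'e \<Rightarrow> nat \<Rightarrow> (('e \<times> bool) \<times> nat) crossing" where
  "band_crossing G e k =
     (let d = (e, True); d' = rev_dart d; k' = nat \<bar>weight G e\<bar> - 1 - k;
          nl = left_arc G d k; nr = (d, k); fr = left_arc G d' k'; fl = (d', k')
      in if weight G e > 0 then Xing nl nr fr fl else Xing nr fr fl nl)"

definition boundary :: "'e plane_graph \<Rightarrow> (('e \<times> bool) \<times> nat) diagram" where
  "boundary G =
     \<lparr>crossings = {band_crossing G e k | e k. e \<in> edges G \<and> k < nat \<bar>weight G e\<bar>}, circles = 0\<rparr>"

definition skip :: "'d \<Rightarrow> ('d \<Rightarrow> 'd) \<Rightarrow> 'd \<Rightarrow> 'd" where
  "skip d \<sigma> x = (if x = d then d else if \<sigma> x = d then \<sigma> d else \<sigma> x)"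

definition delete :: "'e plane_graph \<Rightarrow> 'e \<Rightarrow> 'e plane_graph" where
  "delete G e = G\<lparr>edges := edges G - {e}, rot := skip (e, True) (skip (e, False) (rot G))\<rparr>"

text \<open>
  For an edge with different endpoints, composing with the transposition merges the cycles of
  \<open>rot\<close> at the two endpoints into one: first the darts following \<open>(e, True)\<close> at its tail, then
  those following \<open>(e, False)\<close>.
\<close>

definition contract :: "'e plane_graph \<Rightarrow> 'e \<Rightarrow> 'e plane_graph" where
  "contract G e =
     G\<lparr>edges := edges G - {e},
       rot := skip (e, True) (skip (e, False) (rot G \<circ> transpose (e, True) (e, False)))\<rparr>"

text \<open>
  In contrast to \<open>delete\<close>, this keeps a vertex that is left without edges.  There is no such vertex
  when some path avoiding \<open>e\<close> joins its endpoints, as required of near-alternating diagrams, and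
  then \<open>delete\<close> describes the same graph.
\<close>

definition underlying_without ::
    "'e plane_graph \<Rightarrow> 'e \<Rightarrow> (('e \<times> bool) set, 'e \<times> bool) pre_digraph" where
  "underlying_without G e =
     pre_digraph.del_arc (pre_digraph.del_arc (underlying G) (e, True)) (e, False)"

definition path_length :: "'e plane_graph \<Rightarrow> ('e \<times> bool) list \<Rightarrow> int" where
  "path_length G p = 2 + (\<Sum>d\<leftarrow>p. \<bar>weight G (fst d)\<bar> - 2)"

definition paths_without :: "'e plane_graph \<Rightarrow> 'e \<Rightarrow> ('e \<times> bool) list set" where
  "paths_without G e =
     {p. pre_digraph.apath (underlying_without G e)
           (tail (underlying G) (e, True)) p (head (underlying G) (e, True))}"


section \<open>Near-alternating links\<close>

definition near_alternating_graph :: "'e plane_graph \<Rightarrow> 'e \<Rightarrow> bool" where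
  "near_alternating_graph G e \<longleftrightarrow>
     connected_plane_graph G \<and> two_connected (underlying G) \<and> loopfree_digraph (underlying G) \<and>
     (\<forall>f\<in>edges G. weight G f \<noteq> 0) \<and>
     {f \<in> edges G. weight G f < 0} = {e} \<and> \<bar>weight G e\<bar> \<ge> 2 \<and>
     (let \<omega> = Min (path_length G ` paths_without G e); t = card (paths_without G e)
      in t > 2 \<and> real_of_int \<omega> / real t > real_of_int \<bar>weight G e\<bar>) \<and>
     two_connected (underlying_without G e) \<and>
     prime_diagram (boundary (delete G e)) \<and> twist_reduced (boundary (delete G e)) \<and>
     adequate (boundary (contract G e))"

definition near_alternating :: "'a diagram \<Rightarrow> bool" where
  "near_alternating D \<longleftrightarrow> link_diagram D \<and> non_split D \<and>
     (\<exists>(G :: nat plane_graph) e. near_alternating_graph G e \<and> diagram_iso (boundary G) D)"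

definition near_alternating_link :: "nat diagram set \<Rightarrow> bool" where
  "near_alternating_link L \<longleftrightarrow> L \<in> links \<and> (\<exists>D\<in>L. near_alternating D)"

end

theory Submission
  imports Defs
begin

text \<open>
  Let \<open>e\<close> be the negative edge, with \<open>n = \<bar>r\<bar> \<ge> 2\<close> crossings in its band.  As rational tangles,
  \<open>-1/n = -1 + 1/(1 + 1/(n - 1))\<close>: the band can be replaced by a single negative crossing together
  with \<open>n\<close> positive ones.  To realise this by an isotopy, put a curl on the overstrand of the last
  crossing of the band and pull that strand over the remaining \<open>n - 1\<close> crossings, one first move
  and \<open>n - 1\<close> third moves; each crossing passed is turned by a quarter and becomes positive.  The
  positive edges form an alternating diagram, and the checkerboard pattern
  of over- and undercrossings at the four arcs leaving the band of \<open>e\<close> makes the new diagram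
  alternating after the change of the one negative crossing.  The four arcs leaving the band are
  distinct and end at positive crossings because \<open>e\<close> is not a loop and some path avoiding \<open>e\<close>
  joins its endpoints.

  Each diagram in between has to be planar, so the moves are shown to preserve the Euler
  characteristic.  To this end the regions are described as the classes of the corners under the
  relation generated by one pair for each end of an arc: the two corners that border the same side of
  that arc.
\<close>

section \<open>Counting classes\<close>

text \<open>The closure lives on the whole type and a carrier is chosen only when the quotient is
  formed, so a single corner can later be left out of a count.\<close>

definition eqc :: "('a \<times> 'a) set \<Rightarrow> ('a \<times> 'a) set" where
  "eqc r = (r \<union> r\<inverse>)\<^sup>*"

lemma eqc_refl [simp]: "(x, x) \<in> eqc r"
  by (simp add: eqc_def)

lemma eqc_base: "(x, y) \<in> r \<Longrightarrow> (x, y) \<in> eqc r"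
  by (auto simp: eqc_def)

lemma eqc_sym: "(x, y) \<in> eqc r \<Longrightarrow> (y, x) \<in> eqc r"
  unfolding eqc_def
  by (metis converse_Un converse_converse rtrancl_converseI sup_commute)

lemma eqc_trans: "(x, y) \<in> eqc r \<Longrightarrow> (y, z) \<in> eqc r \<Longrightarrow> (x, z) \<in> eqc r"
  unfolding eqc_def by (rule rtrancl_trans)

lemma eqc_Image_eq_iff: "eqc r `` {x} = eqc r `` {y} \<longleftrightarrow> (x, y) \<in> eqc r"
  by (auto intro: eqc_trans eqc_sym)

lemma eqc_lift:
  assumes "\<And>x y. (x, y) \<in> r \<Longrightarrow> (p x, p y) \<in> eqc s" and "(x, y) \<in> eqc r"
  shows "(p x, p y) \<in> eqc s"
  using assms(2)[unfolded eqc_def]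
proof (induction rule: rtrancl_induct)
  case (step y z)
  then have "(p y, p z) \<in> eqc s"
    using assms(1) eqc_sym by fast
  with step.IH show ?case
    by (rule eqc_trans)
qed simp

lemma quotient_image: "A // r = (\<lambda>x. r `` {x}) ` A"
  by (auto simp: quotient_def)

text \<open>Both images are in bijection with the classes of the common kernel of \<open>f\<close>
  and \<open>g\<close> on \<open>A\<close>.\<close>

lemma card_image_cong:
  assumes "\<And>x y. x \<in> A \<Longrightarrow> y \<in> A \<Longrightarrow> f x = f y \<longleftrightarrow> g x = g y"
  shows "card (f ` A) = card (g ` A)"
proof -
  let ?h = "\<lambda>c. f (inv_into A g c)"
  have h: "?h (g x) = f x" if "x \<in> A" for x
    using that assms f_inv_into_f[of "g x" g A] inv_into_into[of "g x" g A] by blast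
  then have "bij_betw ?h (g ` A) (f ` A)"
    using assms by (auto simp: bij_betw_def inj_on_def image_image)
  then show ?thesis
    by (metis bij_betw_same_card)
qed

text \<open>Being inverse to each other up to the two relations, \<open>p\<close> and
  \<open>q\<close> induce mutually inverse maps on classes; neither has to be injective, and
  compatibility is checked on generators only. Regions and components are compared in this way
  throughout.\<close>

lemma card_quotient_eqc:
  assumes p: "\<And>x y. (x, y) \<in> r \<Longrightarrow> (p x, p y) \<in> eqc s"
    and q: "\<And>x y. (x, y) \<in> s \<Longrightarrow> (q x, q y) \<in> eqc r"
    and pA: "\<And>x. x \<in> A \<Longrightarrow> p x \<in> B" and qB: "\<And>y. y \<in> B \<Longrightarrow> q y \<in> A"
    and qp: "\<And>x. x \<in> A \<Longrightarrow> (q (p x), x) \<in> eqc r"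
    and pq: "\<And>y. y \<in> B \<Longrightarrow> (p (q y), y) \<in> eqc s"
  shows "card (A // eqc r) = card (B // eqc s)"
proof -
  have inv: "(p x, p y) \<in> eqc s \<longleftrightarrow> (x, y) \<in> eqc r" if "x \<in> A" "y \<in> A" for x y
    using eqc_lift[of r p s, OF p] eqc_lift[of s q r, OF q] qp[OF that(1)] qp[OF that(2)]
      eqc_sym eqc_trans by metis
  define F where "F x = eqc s `` {p x}" for x
  have "F ` A = B // eqc s"
  proof
    show "F ` A \<subseteq> B // eqc s"
      using pA by (auto simp: F_def quotient_image)
    show "B // eqc s \<subseteq> F ` A"
    proof
      fix C assume "C \<in> B // eqc s"
      then obtain y where y: "y \<in> B" "C = eqc s `` {y}"
        by (auto simp: quotient_image)
      then have "C = F (q y)"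
        using eqc_sym[OF pq] by (simp add: F_def eqc_Image_eq_iff)
      then show "C \<in> F ` A"
        using qB y by auto
    qed
  qed
  moreover have "card (F ` A) = card ((\<lambda>x. eqc r `` {x}) ` A)"
    by (rule card_image_cong) (simp add: F_def eqc_Image_eq_iff inv)
  ultimately show ?thesis
    by (simp add: quotient_image)
qed

text \<open>An injective self-map of a finite set is a permutation, so a forward orbit also contains
  all predecessors and is a whole class.\<close>

lemma orbit_eq_eqc_Image:
  assumes "finite A" "f ` A \<subseteq> A" "inj_on f A" "a \<in> A"
  shows "orbit f a = eqc {(x, f x) |x. x \<in> A} `` {a}" (is "_ = eqc ?r `` _")
proof -
  have sub: "orbit f a \<subseteq> A"
  proof
    fix x assume "x \<in> orbit f a"
    then show "x \<in> A"
      by induction (use assms in auto)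
  qed
  have "f ` orbit f a = orbit f a"
    using sub assms(1,3)
    by (intro endo_inj_surj) (auto intro: finite_subset inj_on_subset orbit.intros)
  then have pred: "x \<in> orbit f a" if x: "x \<in> A" "f x \<in> orbit f a" for x
  proof -
    obtain y where "y \<in> orbit f a" "f y = f x"
      using x(2) \<open>f ` orbit f a = orbit f a\<close> by force
    then show ?thesis
      using sub inj_onD[OF assms(3), of y x] x(1) by blast
  qed
  show ?thesis
  proof
    show "orbit f a \<subseteq> eqc ?r `` {a}"
    proof
      fix x assume "x \<in> orbit f a"
      then show "x \<in> eqc ?r `` {a}"
      proof induction
        case base
        then show ?case
          using assms by (auto intro: eqc_base)
      next
        case (step y)
        then have "(a, y) \<in> eqc ?r" and "(y, f y) \<in> ?r"
          using sub by auto
        then have "(a, f y) \<in> eqc ?r"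
          by (rule eqc_trans[OF _ eqc_base])
        then show ?case
          by simp
      qed
    qed
    show "eqc ?r `` {a} \<subseteq> orbit f a"
    proof
      fix x assume "x \<in> eqc ?r `` {a}"
      then have "(a, x) \<in> (?r \<union> ?r\<inverse>)\<^sup>*"
        by (simp add: eqc_def)
      then show "x \<in> orbit f a"
      proof (induction rule: rtrancl_induct)
        case base
        then show ?case
          using pred assms(4) orbit.base by metis
      next
        case (step y z)
        then show ?case
          using pred by (auto intro: orbit.intros)
      qed
    qed
  qed
qed

section \<open>Ends and regions\<close>

text \<open>This is \<open>link_diagram\<close> without planarity. It makes \<open>other_end\<close>
  an involution without fixed points on the ends, and it is what is verified of a diagram after a
  crossing change.\<close>

definition proper :: "'a diagram \<Rightarrow> bool" where
  "proper D \<longleftrightarrow> finite (crossings D) \<and>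
     (\<forall>a\<in>labels (crossings D). card {h \<in> ends D. arc_of h = a} = 2)"

text \<open>The corner \<open>h\<close> follows the half-arc \<open>h\<close> counterclockwise, so
  \<open>h\<close> and \<open>prev_end h\<close>, read as corners, are the two corners flanking that
  half-arc.\<close>

definition prev_end :: "'a crossing \<times> nat \<Rightarrow> 'a crossing \<times> nat" where
  "prev_end h = (fst h, (snd h + 3) mod 4)"

text \<open>Left and right are exchanged when an arc is seen from its far end; hence the corner
  \<open>other_end D h\<close> borders the same side of the arc as
  \<open>prev_end h\<close>.\<close>

definition region_rel :: "'a diagram \<Rightarrow> (('a crossing \<times> nat) \<times> ('a crossing \<times> nat)) set" where
  "region_rel D = {(other_end D h, prev_end h) |h. h \<in> ends D}"

lemma link_diagram_iff:
  "link_diagram D \<longleftrightarrow> proper D \<and>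
     int (card (crossings D)) - int (card (labels (crossings D))) + int (card (regions D))
       = 2 * int (card (components D))"
  by (auto simp: link_diagram_def proper_def)

lemma less_4_iff: "(i :: nat) < 4 \<longleftrightarrow> i = 0 \<or> i = 1 \<or> i = 2 \<or> i = 3"
  by auto

lemma arc_at_simps [simp]:
  "arc_at (Xing a b c d) 0 = a" "arc_at (Xing a b c d) (Suc 0) = b"
  "arc_at (Xing a b c d) 2 = c" "arc_at (Xing a b c d) (Suc (Suc 0)) = c" "arc_at (Xing a b c d) 3 = d"
  by simp_all

declare arc_at.simps [simp del]

lemma lessThan_4: "{..<4 :: nat} = {0, 1, 2, 3}"
  by auto

lemma arc_at_image: "arc_at x ` {..<4} = set_crossing x"
  by (cases x) (simp add: lessThan_4)

lemma labels_eq_arc_of: "labels (crossings D) = arc_of ` ends D"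
  by (force simp: labels_def ends_def arc_of_def arc_at_image[symmetric])

lemma finite_ends: "finite (crossings D) \<Longrightarrow> finite (ends D)"
  by (simp add: ends_def)

lemma prev_end_in [simp]: "prev_end h \<in> ends D \<longleftrightarrow> fst h \<in> crossings D"
  by (simp add: ends_def prev_end_def)

lemma inj_prev_end: "inj_on prev_end (ends D)"
  by (auto simp: inj_on_def prev_end_def ends_def less_4_iff)

lemma proper_other_end:
  assumes "proper D" "h \<in> ends D"
  shows other_end_in: "other_end D h \<in> ends D"
    and other_end_neq: "other_end D h \<noteq> h"
    and arc_of_other_end: "arc_of (other_end D h) = arc_of h"
    and other_end_eqI: "h' \<in> ends D \<Longrightarrow> h' \<noteq> h \<Longrightarrow> arc_of h' = arc_of h \<Longrightarrow> other_end D h = h'"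
proof -
  let ?S = "{h' \<in> ends D. arc_of h' = arc_of h}"
  have "card ?S = 2"
    using assms by (simp add: proper_def labels_eq_arc_of)
  then obtain u v where uv: "?S = {u, v}" "u \<noteq> v"
    by (auto simp: card_2_iff)
  then have "\<exists>!h'. h' \<in> ?S \<and> h' \<noteq> h"
  proof -
    have "h = u \<or> h = v"
      using assms(2) uv(1) by blast
    then show ?thesis
      unfolding uv(1) using uv(2) by blast
  qed
  then have "\<exists>!h'. h' \<in> ends D \<and> h' \<noteq> h \<and> arc_of h' = arc_of h"
    by (simp only: mem_Collect_eq conj_ac)
  note ex = theI'[OF this, folded other_end_def] the1_equality[OF this, folded other_end_def]
  show "other_end D h \<in> ends D" "other_end D h \<noteq> h" "arc_of (other_end D h) = arc_of h"
    using ex(1) by blast+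
  show "h' \<in> ends D \<Longrightarrow> h' \<noteq> h \<Longrightarrow> arc_of h' = arc_of h \<Longrightarrow> other_end D h = h'"
    using ex(2) by blast
qed

lemma other_end_other_end: "proper D \<Longrightarrow> h \<in> ends D \<Longrightarrow> other_end D (other_end D h) = h"
  by (metis other_end_eqI other_end_in other_end_neq arc_of_other_end)

lemma region_step_prev: "region_step D h = prev_end (other_end D h)"
  by (simp add: region_step_def prev_end_def Let_def)

text \<open>Reindexing the pairs along the involution \<open>other_end\<close> turns them into the
  steps of \<open>region_step\<close>.\<close>

lemma region_rel_step:
  assumes "proper D"
  shows "region_rel D = {(h, region_step D h) |h. h \<in> ends D}"
proof -
  have "\<exists>h'. other_end D h = h' \<and> prev_end h = region_step D h' \<and> h' \<in> ends D"
    "\<exists>h'. h = other_end D h' \<and> region_step D h = prev_end h' \<and> h' \<in> ends D" if "h \<in> ends D" for h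
    using other_end_other_end[OF assms that] other_end_in[OF assms that]
    by (metis region_step_prev)+
  then show ?thesis
    unfolding region_rel_def by blast
qed

text \<open>\<open>region_step\<close> is an injective self-map of the finite set of ends, so its
  orbits are classes.\<close>

lemma regions_eq:
  assumes "proper D"
  shows "regions D = ends D // eqc (region_rel D)"
proof -
  have fin: "finite (ends D)"
    using assms by (simp add: proper_def finite_ends)
  have "inj_on (other_end D) (ends D)"
    by (rule inj_on_inverseI[of _ "other_end D"]) (rule other_end_other_end[OF assms])
  then have "inj_on (region_step D) (ends D)"
    using inj_prev_end[of D] other_end_in[OF assms]
    unfolding inj_on_def region_step_prev by metis
  moreover have "region_step D ` ends D \<subseteq> ends D"
    using other_end_in[OF assms]
    by (auto simp: region_step_prev prev_end_def ends_def mem_Times_iff simp del: split_paired_All)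
  ultimately show ?thesis
    unfolding regions_def quotient_image region_rel_step[OF assms]
    by (intro image_cong refl orbit_eq_eqc_Image fin)
qed

text \<open>\<open>adjacent\<close> is symmetric, and reflexive on the crossings, so there its
  transitive closure is already the generated equivalence.\<close>

lemma components_eq: "components D = crossings D // eqc (adjacent D)"
proof -
  have "refl_on (crossings D) (adjacent D)"
  proof -
    have "set_crossing x \<noteq> {}" for x :: "'a crossing"
      by (cases x) auto
    then show ?thesis
      by (auto simp: refl_on_def adjacent_def)
  qed
  then have "(adjacent D)\<^sup>+ `` {x} = eqc (adjacent D) `` {x}" if "x \<in> crossings D" for x
  proof -
    have "adjacent D \<union> (adjacent D)\<inverse> = adjacent D"
      by (auto simp: adjacent_def)
    moreover have "(x, x) \<in> adjacent D"
      using \<open>refl_on _ _\<close> that by (auto simp: refl_on_def)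
    ultimately show ?thesis
      by (auto simp: eqc_def trancl_into_rtrancl rtrancl_eq_or_trancl)
  qed
  then show ?thesis
    unfolding components_def quotient_image by (intro image_cong refl)
qed

text \<open>Each block lies in one component of its diagram, and both share the same arcs with
  \<open>K\<close>. Collapsing a block to its representative \<open>P\<close> or \<open>P'\<close>
  therefore identifies the components of the two diagrams.\<close>

lemma components_block:
  assumes BK: "B \<inter> K = {}" "B' \<inter> K = {}" and P: "P \<in> B" "P' \<in> B'"
    and B: "\<And>x. x \<in> B \<Longrightarrow> (x, P) \<in> eqc (adjacent \<lparr>crossings = B \<union> K, circles = n\<rparr>)"
    and B': "\<And>x. x \<in> B' \<Longrightarrow> (x, P') \<in> eqc (adjacent \<lparr>crossings = B' \<union> K, circles = n'\<rparr>)"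
    and lab: "labels B \<inter> labels K = labels B' \<inter> labels K"
  shows "card (components \<lparr>crossings = B \<union> K, circles = n\<rparr>)
    = card (components \<lparr>crossings = B' \<union> K, circles = n'\<rparr>)"
proof -
  have lift: "((if x \<in> K then x else P'), (if y \<in> K then y else P')) \<in> eqc (adjacent D')"
    if xy: "(x, y) \<in> adjacent \<lparr>crossings = B \<union> K, circles = n\<rparr>"
      and lab: "labels B \<inter> labels K \<subseteq> labels B'"
      and D': "D' = \<lparr>crossings = B' \<union> K, circles = n'\<rparr>"
      and B': "\<And>x. x \<in> B' \<Longrightarrow> (x, P') \<in> eqc (adjacent D')"
    for x y n n' B B' P' and D' :: "'a diagram"
  proof -
    \<comment> \<open>An arc shared by \<open>u\<close> and the old block also occurs in the new
      block, so \<open>u\<close> remains connected to the representative.\<close>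
    have out: "(u, P') \<in> eqc (adjacent D')"
      if "u \<in> K" "v \<in> B" "set_crossing u \<inter> set_crossing v \<noteq> {}" for u v
    proof -
      obtain a where a: "a \<in> set_crossing u" "a \<in> set_crossing v"
        using \<open>set_crossing u \<inter> set_crossing v \<noteq> {}\<close> by blast
      then have "a \<in> labels B'"
        using \<open>u \<in> K\<close> \<open>v \<in> B\<close> lab by (auto simp: labels_def)
      then obtain z where z: "z \<in> B'" "a \<in> set_crossing z"
        by (auto simp: labels_def)
      then have "(u, z) \<in> adjacent D'"
        using a \<open>u \<in> K\<close> by (auto simp: adjacent_def D')
      then show ?thesis
        using B'[OF z(1)] by (blast intro: eqc_trans eqc_base)
    qed
    show ?thesis
      using xy out[of x y] out[of y x]
      by (auto simp: adjacent_def D' Int_commute intro: eqc_base eqc_sym)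
  qed
  let ?D = "\<lparr>crossings = B \<union> K, circles = n\<rparr>" and ?D' = "\<lparr>crossings = B' \<union> K, circles = n'\<rparr>"
  show ?thesis
    unfolding components_eq
  proof (rule card_quotient_eqc)
    show "((if x \<in> K then x else P'), (if y \<in> K then y else P')) \<in> eqc (adjacent ?D')"
      if "(x, y) \<in> adjacent ?D" for x y
      using lift[OF that _ refl B'] lab by blast
    show "((if x \<in> K then x else P), (if y \<in> K then y else P)) \<in> eqc (adjacent ?D)"
      if "(x, y) \<in> adjacent ?D'" for x y
      using lift[OF that _ refl B] lab by blast
    show "((if (if x \<in> K then x else P') \<in> K then (if x \<in> K then x else P') else P), x)
        \<in> eqc (adjacent ?D)" if "x \<in> crossings ?D" for x
      using that B BK P by (auto intro: eqc_sym)
    show "((if (if x \<in> K then x else P) \<in> K then (if x \<in> K then x else P) else P'), x)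
        \<in> eqc (adjacent ?D')" if "x \<in> crossings ?D'" for x
      using that B' BK P by (auto intro: eqc_sym)
  qed (use P in auto)
qed

section \<open>Diagrams whose ends correspond arc by arc\<close>

locale ends_bij =
  fixes D :: "'a diagram" and D' :: "'a diagram" and \<sigma> :: "'a crossing \<times> nat \<Rightarrow> 'a crossing \<times> nat"
  assumes proper: "proper D"
    and bij: "bij_betw \<sigma> (ends D) (ends D')"
    and arc: "\<And>h. h \<in> ends D \<Longrightarrow> arc_of (\<sigma> h) = arc_of h"
begin

lemma ends_eq: "ends D' = \<sigma> ` ends D"
  using bij by (simp add: bij_betw_def)

lemma labels_eq: "labels (crossings D') = labels (crossings D)"
  by (simp add: labels_eq_arc_of ends_eq image_image arc cong: image_cong)

lemma finite_crossings': "finite (crossings D')"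
proof -
  have "finite (ends D')"
    using bij proper finite_ends bij_betw_finite unfolding proper_def by blast
  then show ?thesis
    unfolding ends_def by (rule finite_cartesian_productD1) (simp add: lessThan_4)
qed

lemma card_crossings_eq: "card (crossings D') = card (crossings D)"
  using bij_betw_same_card[OF bij] by (simp add: ends_def card_cartesian_product)

lemma proper': "proper D'"
  unfolding proper_def
proof (intro conjI ballI finite_crossings')
  fix a assume "a \<in> labels (crossings D')"
  then have "card {h \<in> ends D. arc_of h = a} = 2"
    using proper by (simp add: proper_def labels_eq)
  moreover have "{h \<in> ends D'. arc_of h = a} = \<sigma> ` {h \<in> ends D. arc_of h = a}"
    using arc by (auto simp: ends_eq)
  moreover have "inj_on \<sigma> {h \<in> ends D. arc_of h = a}"
    using bij by (auto simp: bij_betw_def intro: inj_on_subset)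
  ultimately show "card {h \<in> ends D'. arc_of h = a} = 2"
    by (simp add: card_image)
qed

lemma map_end_in: "h \<in> ends D \<Longrightarrow> \<sigma> h \<in> ends D'"
  using bij by (auto simp: bij_betw_def)

lemma other_end_map:
  assumes "h \<in> ends D"
  shows "other_end D' (\<sigma> h) = \<sigma> (other_end D h)"
proof (rule other_end_eqI[OF proper'])
  have o: "other_end D h \<in> ends D"
    using other_end_in[OF proper assms] .
  show "\<sigma> h \<in> ends D'" "\<sigma> (other_end D h) \<in> ends D'"
    using assms o map_end_in by auto
  show "\<sigma> (other_end D h) \<noteq> \<sigma> h"
    using bij other_end_neq[OF proper assms] o assms by (auto simp: bij_betw_def inj_on_def)
  show "arc_of (\<sigma> (other_end D h)) = arc_of (\<sigma> h)"
    using arc o assms arc_of_other_end[OF proper assms] by simp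
qed

lemma ends_bij_inv: "ends_bij D' D (inv_into (ends D) \<sigma>)"
proof
  show "proper D'"
    by (rule proper')
  show "bij_betw (inv_into (ends D) \<sigma>) (ends D') (ends D)"
    using bij by (rule bij_betw_inv_into)
  show "arc_of (inv_into (ends D) \<sigma> h) = arc_of h" if "h \<in> ends D'" for h
    using that bij arc by (metis bij_betw_def f_inv_into_f inv_into_into)
qed

text \<open>The bijection preserves the numbers of arcs and crossings but may alter the cyclic order
  at a crossing, so of the Euler characteristic only regions and components are left to
  compare.\<close>

lemma link_diagram':
  assumes "link_diagram D" "card (regions D') = card (regions D)"
    "card (components D') = card (components D)"
  shows "link_diagram D'"
  using assms proper' by (simp add: link_diagram_iff labels_eq card_crossings_eq)

text \<open>
  An arc whose ends move along with \<open>\<sigma>\<close> needs to be checked on one side only: \<open>p\<close> then maps the corner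
  on its other side to the right place automatically.
\<close>

lemma region_rel_lift:
  assumes "(x, y) \<in> region_rel D"
    and "\<And>h. h \<in> ends D \<Longrightarrow> arc_of h \<notin> I \<Longrightarrow> p h = \<sigma> h"
    and "\<And>h. h \<in> ends D \<Longrightarrow> arc_of h \<notin> I \<Longrightarrow>
      (p (prev_end h), prev_end (\<sigma> h)) \<in> eqc (region_rel D')"
    and "\<And>h. h \<in> ends D \<Longrightarrow> arc_of h \<in> I \<Longrightarrow>
      (p (other_end D h), p (prev_end h)) \<in> eqc (region_rel D')"
  shows "(p x, p y) \<in> eqc (region_rel D')"
proof -
  obtain h where h: "x = other_end D h" "y = prev_end h" "h \<in> ends D"
    using assms(1) by (auto simp: region_rel_def)
  show ?thesis
  proof (cases "arc_of h \<in> I")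
    case True
    then show ?thesis
      using assms(4) h by simp
  next
    case False
    \<comment> \<open>The other end carries the same label, so it also lies outside \<open>I\<close>
      and \<open>p\<close> agrees with \<open>\<sigma>\<close> on it.\<close>
    then have "p x = other_end D' (\<sigma> h)"
      using assms(2)[of "other_end D h"] h other_end_in[OF proper h(3)]
        arc_of_other_end[OF proper h(3)] other_end_map by simp
    moreover have "(other_end D' (\<sigma> h), prev_end (\<sigma> h)) \<in> region_rel D'"
      using map_end_in[OF h(3)] unfolding region_rel_def by blast
    ultimately show ?thesis
      using assms(3)[OF h(3) False] h(2) by (metis eqc_base eqc_sym eqc_trans)
  qed
qed

end

text \<open>A half turn renumbers the ends of a crossing cyclically, by two places; this commutes
  with \<open>prev_end\<close>, so regions go to regions. The lemma allows the crossings of a band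
  to be listed in the form that the moves require.\<close>

lemma link_diagram_half_turns:
  assumes D: "link_diagram D" and g: "bij_betw g (crossings D) (crossings D')"
    and half: "\<And>x. x \<in> crossings D \<Longrightarrow> g x = x \<or> g x = half_turn x"
  shows "link_diagram D'"
proof -
  \<comment> \<open>Because of the test \<open>g (fst h) = fst h\<close>, a crossing that equals its
    own half turn keeps its numbering.\<close>
  define \<sigma> where "\<sigma> h = (g (fst h), if g (fst h) = fst h then snd h else (snd h + 2) mod 4)"
    for h :: "'a crossing \<times> nat"
  have set: "set_crossing (g x) = set_crossing x" if "x \<in> crossings D" for x
    using half[OF that] by (cases x) auto
  have "bij_betw \<sigma> (ends D) (ends D')"
  proof -
    have "inj_on \<sigma> (ends D)"
      using g by (auto simp: inj_on_def bij_betw_def \<sigma>_def ends_def less_4_iff)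
    moreover have "\<sigma> ` ends D = ends D'"
    proof
      show "\<sigma> ` ends D \<subseteq> ends D'"
        using g by (auto simp: \<sigma>_def ends_def bij_betw_def)
      show "ends D' \<subseteq> \<sigma> ` ends D"
      proof
        fix h assume "h \<in> ends D'"
        then obtain x i where h: "h = (g x, i)" "x \<in> crossings D" "i < 4"
          using g by (cases h) (auto simp: ends_def bij_betw_def)
        then have "h = \<sigma> (x, if g x = x then i else (i + 2) mod 4)"
          by (auto simp: \<sigma>_def less_4_iff)
        then show "h \<in> \<sigma> ` ends D"
          using h by (auto simp: ends_def)
      qed
    qed
    ultimately show ?thesis
      by (simp add: bij_betw_def)
  qed
  moreover have "arc_of (\<sigma> h) = arc_of h" if "h \<in> ends D" for h
    using that half[of "fst h"]
    by (cases "fst h") (auto simp: \<sigma>_def arc_of_def ends_def less_4_iff)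
  ultimately interpret ends_bij D D' \<sigma>
    using D by unfold_locales (auto simp: link_diagram_iff)
  interpret inv: ends_bij D' D "inv_into (ends D) \<sigma>"
    by (rule ends_bij_inv)
  have prev: "\<sigma> (prev_end h) = prev_end (\<sigma> h)" if "h \<in> ends D" for h
    using that by (auto simp: \<sigma>_def prev_end_def ends_def less_4_iff)
  let ?\<tau> = "inv_into (ends D) \<sigma>"
  have inv1: "?\<tau> (\<sigma> h) = h" if "h \<in> ends D" for h
    using bij that by (simp add: bij_betw_def)
  have inv2: "\<sigma> (?\<tau> h) = h" if "h \<in> ends D'" for h
    using bij that by (simp add: bij_betw_def f_inv_into_f)
  have prev': "?\<tau> (prev_end h) = prev_end (?\<tau> h)" if "h \<in> ends D'" for h
  proof -
    have "?\<tau> h \<in> ends D"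
      using inv.map_end_in that .
    moreover have "prev_end (?\<tau> h) \<in> ends D"
      using calculation unfolding prev_end_in by (simp add: ends_def mem_Times_iff)
    ultimately show ?thesis
      using prev inv1 inv2[OF that] by metis
  qed
  show ?thesis
  proof (rule link_diagram'[OF D])
    have "card (ends D // eqc (region_rel D)) = card (ends D' // eqc (region_rel D'))"
    proof (rule card_quotient_eqc[of _ \<sigma> _ ?\<tau>])
      show "(\<sigma> x, \<sigma> y) \<in> eqc (region_rel D')" if "(x, y) \<in> region_rel D" for x y
        using that by (rule region_rel_lift[where I = "{}"]) (simp_all add: prev)
      show "(?\<tau> x, ?\<tau> y) \<in> eqc (region_rel D)" if "(x, y) \<in> region_rel D'" for x y
        using that by (rule inv.region_rel_lift[where I = "{}"]) (simp_all add: prev')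
    qed (auto simp: inv1 inv2 map_end_in inv.map_end_in)
    then show "card (regions D') = card (regions D)"
      by (simp add: regions_eq proper proper')
    have ginv: "inv_into (crossings D) g (g x) = x" if "x \<in> crossings D" for x
      using g that by (simp add: bij_betw_def)
    have ginv': "g (inv_into (crossings D) g x) = x" "inv_into (crossings D) g x \<in> crossings D"
      if "x \<in> crossings D'" for x
      using g that by (auto simp: bij_betw_def f_inv_into_f inv_into_into)
    have "card (crossings D // eqc (adjacent D)) = card (crossings D' // eqc (adjacent D'))"
    proof (rule card_quotient_eqc[of _ g _ "inv_into (crossings D) g"])
      show "(g x, g y) \<in> eqc (adjacent D')" if "(x, y) \<in> adjacent D" for x y
        using that g set by (intro eqc_base) (auto simp: adjacent_def bij_betw_def)
      show "(inv_into (crossings D) g x, inv_into (crossings D) g y) \<in> eqc (adjacent D)"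
        if "(x, y) \<in> adjacent D'" for x y
        using that ginv'[of x] ginv'[of y] set[of "inv_into (crossings D) g x"]
          set[of "inv_into (crossings D) g y"]
        by (intro eqc_base) (auto simp: adjacent_def)
    qed (use g ginv ginv' in \<open>auto simp: bij_betw_def\<close>)
    then show "card (components D') = card (components D)"
      by (simp add: components_eq)
  qed
qed

section \<open>Planarity of third moves\<close>

text \<open>A finite table that is the identity elsewhere: the correspondences below change only the
  ends at the crossings of a move.\<close>

definition patch :: "('a \<times> 'a) list \<Rightarrow> 'a \<Rightarrow> 'a" where
  "patch xs x = (case map_of xs x of None \<Rightarrow> x | Some y \<Rightarrow> y)"

lemma patch_outside: "x \<notin> fst ` set xs \<Longrightarrow> patch xs x = x"
  by (simp add: patch_def map_of_eq_None_iff[THEN iffD2])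

lemma ends_insert:
  "ends \<lparr>crossings = insert x K, circles = n\<rparr> =
    {(x, 0), (x, 1), (x, 2), (x, 3)} \<union> ends \<lparr>crossings = K, circles = n\<rparr>"
  by (auto simp: ends_def less_4_iff)

lemma region_relI:
  assumes "proper D" "h \<in> ends D" "h' \<in> ends D" "h' \<noteq> h" "arc_of h' = arc_of h"
  shows "(h', prev_end h) \<in> eqc (region_rel D)"
proof (rule eqc_base)
  have "other_end D h = h'"
    using assms by (rule other_end_eqI)
  then show "(h', prev_end h) \<in> region_rel D"
    using assms(2) unfolding region_rel_def by blast
qed

lemma arc_of_in_labels: "h \<in> ends \<lparr>crossings = K, circles = n\<rparr> \<Longrightarrow> arc_of h \<in> labels K"
  using labels_eq_arc_of[of "\<lparr>crossings = K, circles = n\<rparr>"] by auto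

text \<open>Both sides have three crossings and the same labels, so \<open>ends_bij\<close> applies.
  On the ends of outer arcs the map of corners follows \<open>\<sigma>\<close>; the inner arcs
  \<open>t\<close>, \<open>m\<close>, \<open>b\<close> are treated separately. The outer labels may
  coincide with each other, so the argument works with positions.\<close>

lemma link_diagram_R3:
  fixes K :: "'a crossing set"
  assumes tmb: "distinct [t, m, b]" "{t, m, b} \<inter> labels K = {}"
      "{t, m, b} \<inter> {t1, m1, b1, t2, m2, b2} = {}"
    and D: "link_diagram
      \<lparr>crossings = {Xing m1 t m t1, Xing b1 t2 b t, Xing b m2 b2 m} \<union> K, circles = n\<rparr>" (is "link_diagram ?D")
  shows "link_diagram
      \<lparr>crossings = {Xing m t2 m2 t, Xing b t b2 t1, Xing b1 m b m1} \<union> K, circles = n\<rparr>" (is "link_diagram ?D'")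
proof -
  define P1 P2 P3 where P: "P1 = Xing m1 t m t1" "P2 = Xing b1 t2 b t" "P3 = Xing b m2 b2 m"
  define Q1 Q2 Q3 where Q: "Q1 = Xing m t2 m2 t" "Q2 = Xing b t b2 t1" "Q3 = Xing b1 m b m1"
  define D where "D = \<lparr>crossings = {P1, P2, P3} \<union> K, circles = n\<rparr>"
  define D' where "D' = \<lparr>crossings = {Q1, Q2, Q3} \<union> K, circles = n\<rparr>"
  let ?K = "ends \<lparr>crossings = K, circles = n\<rparr>"
  have neq: "P1 \<noteq> P2" "P1 \<noteq> P3" "P2 \<noteq> P3" "Q1 \<noteq> Q2" "Q1 \<noteq> Q3" "Q2 \<noteq> Q3"
    "P2 \<noteq> P1" "P3 \<noteq> P1" "P3 \<noteq> P2" "Q2 \<noteq> Q1" "Q3 \<noteq> Q1" "Q3 \<noteq> Q2"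
    using tmb by (auto simp: P Q)
  have notin: "P1 \<notin> K" "P2 \<notin> K" "P3 \<notin> K" "Q1 \<notin> K" "Q2 \<notin> K" "Q3 \<notin> K"
    using tmb(2) by (force simp: P Q labels_def)+
  have arcs: "arc_of (P1, 0) = m1" "arc_of (P1, 1) = t" "arc_of (P1, 2) = m" "arc_of (P1, 3) = t1"
    "arc_of (P2, 0) = b1" "arc_of (P2, 1) = t2" "arc_of (P2, 2) = b" "arc_of (P2, 3) = t"
    "arc_of (P3, 0) = b" "arc_of (P3, 1) = m2" "arc_of (P3, 2) = b2" "arc_of (P3, 3) = m"
    "arc_of (Q1, 0) = m" "arc_of (Q1, 1) = t2" "arc_of (Q1, 2) = m2" "arc_of (Q1, 3) = t"
    "arc_of (Q2, 0) = b" "arc_of (Q2, 1) = t" "arc_of (Q2, 2) = b2" "arc_of (Q2, 3) = t1"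
    "arc_of (Q3, 0) = b1" "arc_of (Q3, 1) = m" "arc_of (Q3, 2) = b" "arc_of (Q3, 3) = m1"
    by (simp_all add: P Q arc_of_def)
  have ends: "ends D = {(P1, 0), (P1, 1), (P1, 2), (P1, 3), (P2, 0), (P2, 1), (P2, 2), (P2, 3),
      (P3, 0), (P3, 1), (P3, 2), (P3, 3)} \<union> ?K"
    by (simp add: D_def ends_insert) blast
  have ends': "ends D' = {(Q1, 0), (Q1, 1), (Q1, 2), (Q1, 3), (Q2, 0), (Q2, 1), (Q2, 2), (Q2, 3),
      (Q3, 0), (Q3, 1), (Q3, 2), (Q3, 3)} \<union> ?K"
    by (simp add: D'_def ends_insert) blast
  \<comment> \<open>An outer arc keeps its boundary point on the disk, but its strand now meets the
    other of its two crossings first.\<close>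
  define \<sigma> where "\<sigma> = patch [((P1, 0), (Q3, 3)), ((P1, 1), (Q2, 1)), ((P1, 2), (Q3, 1)),
    ((P1, 3), (Q2, 3)), ((P2, 0), (Q3, 0)), ((P2, 1), (Q1, 1)), ((P2, 2), (Q3, 2)),
    ((P2, 3), (Q1, 3)), ((P3, 0), (Q2, 0)), ((P3, 1), (Q1, 2)), ((P3, 2), (Q2, 2)), ((P3, 3), (Q1, 0 :: nat))]"
  define \<tau> where "\<tau> = patch [((Q3, 3), (P1, 0)), ((Q2, 1), (P1, 1)), ((Q3, 1), (P1, 2)),
    ((Q2, 3), (P1, 3)), ((Q3, 0), (P2, 0)), ((Q1, 1), (P2, 1)), ((Q3, 2), (P2, 2)),
    ((Q1, 3), (P2, 3)), ((Q2, 0), (P3, 0)), ((Q1, 2), (P3, 1)), ((Q2, 2), (P3, 2)), ((Q1, 0), (P3, 3 :: nat))]"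
  \<comment> \<open>The six outer regions go to the outer regions, the triangle to the triangle.\<close>
  define p where "p = patch [((P1, 0), (Q3, 3)), ((P2, 3), (Q3, 3)), ((P1, 3), (Q2, 3)),
    ((P2, 0), (Q3, 0)), ((P2, 1), (Q1, 1)), ((P3, 0), (Q1, 1)), ((P3, 1), (Q1, 2)),
    ((P3, 2), (Q2, 2)), ((P1, 2), (Q2, 2)), ((P1, 1), (Q1, 3)), ((P2, 2), (Q1, 3)), ((P3, 3), (Q1, 3 :: nat))]"
  \<comment> \<open>\<open>q\<close> inverts \<open>p\<close> only up to equality of regions, since
    different corners of one region may have the same image.\<close>
  define q where "q = patch [((Q3, 3), (P1, 0)), ((Q2, 3), (P1, 3)), ((Q3, 2), (P1, 3)),
    ((Q3, 0), (P2, 0)), ((Q1, 0), (P2, 0)), ((Q1, 1), (P2, 1)), ((Q1, 2), (P3, 1)), ((Q2, 1), (P3, 1)),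
    ((Q2, 2), (P3, 2)), ((Q1, 3), (P1, 1)), ((Q2, 0), (P1, 1)), ((Q3, 1), (P1, 1 :: nat))]"
  have K: "\<sigma> h = h" "\<tau> h = h" "p h = h" "q h = h" "prev_end h \<in> ?K" "arc_of h \<notin> {t, m, b}"
    if "h \<in> ?K" for h
    using that notin tmb(2) arc_of_in_labels[OF that]
    by (auto simp: \<sigma>_def \<tau>_def p_def q_def ends_def prev_end_def intro!: patch_outside)
  note tables = \<sigma>_def \<tau>_def p_def q_def patch_def neq
  have bij: "bij_betw \<sigma> (ends D) (ends D')"
    by (rule bij_betw_byWitness[of _ \<tau>])
      (unfold ends ends', auto simp: K, simp_all add: tables)
  moreover have "arc_of (\<sigma> h) = arc_of h" if "h \<in> ends D" for h
    using that[unfolded ends] K by (auto simp: tables arcs[simplified])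
  moreover have "proper D"
    using D by (simp add: link_diagram_iff D_def P)
  ultimately interpret ends_bij D D' \<sigma>
    by unfold_locales
  have bij': "bij_betw \<tau> (ends D') (ends D)"
    by (rule bij_betw_byWitness[of _ \<sigma>])
      (unfold ends ends', auto simp: K, simp_all add: tables)
  moreover have "arc_of (\<tau> h) = arc_of h" if "h \<in> ends D'" for h
    using that[unfolded ends'] K by (auto simp: tables arcs[simplified])
  ultimately interpret inv: ends_bij D' D \<tau>
    using proper' by unfold_locales
  note rel = region_relI[OF proper, unfolded ends] region_relI[OF proper', unfolded ends']
  \<comment> \<open>Each inner arc gives two pairs: one inside the triangle, one in the outer region
    across the arc.\<close>
  have r: "((P2, 3), (P1, 0)) \<in> eqc (region_rel D)" "((P1, 1), (P2, 2)) \<in> eqc (region_rel D)"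
    "((P3, 3), (P1, 1)) \<in> eqc (region_rel D)" "((P1, 2), (P3, 2)) \<in> eqc (region_rel D)"
    "((P3, 0), (P2, 1)) \<in> eqc (region_rel D)" "((P2, 2), (P3, 3)) \<in> eqc (region_rel D)"
    using rel(1)[of "(P1, 1)" "(P2, 3)"] rel(1)[of "(P2, 3)" "(P1, 1)"]
      rel(1)[of "(P1, 2)" "(P3, 3)"] rel(1)[of "(P3, 3)" "(P1, 2)"]
      rel(1)[of "(P2, 2)" "(P3, 0)"] rel(1)[of "(P3, 0)" "(P2, 2)"]
    by (simp_all add: neq arcs[simplified] prev_end_def)
  have r': "((Q1, 3), (Q2, 0)) \<in> eqc (region_rel D')" "((Q2, 1), (Q1, 2)) \<in> eqc (region_rel D')"
    "((Q1, 0), (Q3, 0)) \<in> eqc (region_rel D')" "((Q3, 1), (Q1, 3)) \<in> eqc (region_rel D')"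
    "((Q2, 0), (Q3, 1)) \<in> eqc (region_rel D')" "((Q3, 2), (Q2, 3)) \<in> eqc (region_rel D')"
    using rel(2)[of "(Q2, 1)" "(Q1, 3)"] rel(2)[of "(Q1, 3)" "(Q2, 1)"]
      rel(2)[of "(Q3, 1)" "(Q1, 0)"] rel(2)[of "(Q1, 0)" "(Q3, 1)"]
      rel(2)[of "(Q3, 2)" "(Q2, 0)"] rel(2)[of "(Q2, 0)" "(Q3, 2)"]
    by (simp_all add: neq arcs[simplified] prev_end_def)
  note rr = r[simplified] r[THEN eqc_sym, simplified] r'[simplified] r'[THEN eqc_sym, simplified]
  have oth: "other_end D (P1, 1) = (P2, 3)" "other_end D (P2, 3) = (P1, 1)"
     "other_end D (P1, 2) = (P3, 3)" "other_end D (P3, 3) = (P1, 2)"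
     "other_end D (P2, 2) = (P3, 0)" "other_end D (P3, 0) = (P2, 2)"
    by (rule other_end_eqI[OF proper]; simp add: ends neq arcs[simplified])+
  have oth': "other_end D' (Q2, 1) = (Q1, 3)" "other_end D' (Q1, 3) = (Q2, 1)"
     "other_end D' (Q3, 1) = (Q1, 0)" "other_end D' (Q1, 0) = (Q3, 1)"
     "other_end D' (Q3, 2) = (Q2, 0)" "other_end D' (Q2, 0) = (Q3, 2)"
    by (rule other_end_eqI[OF proper']; simp add: ends' neq arcs[simplified])+
  have regs: "card (ends D // eqc (region_rel D)) = card (ends D' // eqc (region_rel D'))"
  proof (rule card_quotient_eqc[of _ p _ q])
    have 1: "p h = \<sigma> h" "(p (prev_end h), prev_end (\<sigma> h)) \<in> eqc (region_rel D')"
      if h: "h \<in> ends D" "arc_of h \<notin> {t, m, b}" for h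
    proof -
      consider "h \<in> ?K" | "h \<in> {(P1, 0), (P1, 3), (P2, 0), (P2, 1), (P3, 1), (P3, 2)}"
        using h[unfolded ends] by (auto simp: arcs[simplified])
      then have "p h = \<sigma> h \<and> (p (prev_end h), prev_end (\<sigma> h)) \<in> eqc (region_rel D')"
      proof cases
        case 1
        then show ?thesis
          using K K(5)[THEN K(3)] by simp
      next
        case 2
        then show ?thesis
          by (elim insertE emptyE) (simp_all add: tables prev_end_def rr)
      qed
      then show "p h = \<sigma> h" "(p (prev_end h), prev_end (\<sigma> h)) \<in> eqc (region_rel D')"
        by auto
    qed
    have 2: "(p (other_end D h), p (prev_end h)) \<in> eqc (region_rel D')"
      if "h \<in> ends D" "arc_of h \<in> {t, m, b}" for h
    proof -
      have "h \<in> {(P1, 1), (P2, 3), (P1, 2), (P3, 3), (P2, 2), (P3, 0)}"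
        using that[unfolded ends] K(6)[of h] tmb(3) by (auto simp: arcs[simplified])
      then show ?thesis
        by (elim insertE emptyE) (simp_all add: oth[simplified] tables prev_end_def rr)
    qed
    show "(p x, p y) \<in> eqc (region_rel D')" if "(x, y) \<in> region_rel D" for x y
      using that 1 2 by (rule region_rel_lift)
    have 1: "q h = \<tau> h" "(q (prev_end h), prev_end (\<tau> h)) \<in> eqc (region_rel D)"
      if h: "h \<in> ends D'" "arc_of h \<notin> {t, m, b}" for h
    proof -
      consider "h \<in> ?K" | "h \<in> {(Q1, 1), (Q1, 2), (Q2, 2), (Q2, 3), (Q3, 0), (Q3, 3)}"
        using h[unfolded ends'] by (auto simp: arcs[simplified])
      then have "q h = \<tau> h \<and> (q (prev_end h), prev_end (\<tau> h)) \<in> eqc (region_rel D)"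
      proof cases
        case 1
        then show ?thesis
          using K K(5)[THEN K(4)] by simp
      next
        case 2
        then show ?thesis
          by (elim insertE emptyE) (simp_all add: tables prev_end_def rr)
      qed
      then show "q h = \<tau> h" "(q (prev_end h), prev_end (\<tau> h)) \<in> eqc (region_rel D)"
        by auto
    qed
    have 2: "(q (other_end D' h), q (prev_end h)) \<in> eqc (region_rel D)"
      if "h \<in> ends D'" "arc_of h \<in> {t, m, b}" for h
    proof -
      have "h \<in> {(Q2, 1), (Q1, 3), (Q3, 1), (Q1, 0), (Q3, 2), (Q2, 0)}"
        using that[unfolded ends'] K(6)[of h] tmb(3) by (auto simp: arcs[simplified])
      then show ?thesis
        by (elim insertE emptyE) (simp_all add: oth'[simplified] tables prev_end_def rr)
    qed
    show "(q x, q y) \<in> eqc (region_rel D)" if "(x, y) \<in> region_rel D'" for x y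
      using that 1 2 by (rule inv.region_rel_lift)
    show "p x \<in> ends D'" if "x \<in> ends D" for x
      using that[unfolded ends] by (auto simp: K ends') (simp_all add: tables)
    show "q x \<in> ends D" if "x \<in> ends D'" for x
      using that[unfolded ends'] by (auto simp: K ends) (simp_all add: tables)
    show "(q (p x), x) \<in> eqc (region_rel D)" if "x \<in> ends D" for x
      using that[unfolded ends] by (auto simp: K) (simp_all add: tables rr)
    show "(p (q x), x) \<in> eqc (region_rel D')" if "x \<in> ends D'" for x
      using that[unfolded ends'] by (auto simp: K) (simp_all add: tables rr)
  qed
  have comps: "card (components D) = card (components D')"
    unfolding D_def D'_def
  proof (rule components_block[of _ _ _ P1 Q1])
    show "labels {P1, P2, P3} \<inter> labels K = labels {Q1, Q2, Q3} \<inter> labels K"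
      using tmb(2) by (auto simp: labels_def P Q)
    show "(x, P1) \<in> eqc (adjacent \<lparr>crossings = {P1, P2, P3} \<union> K, circles = n\<rparr>)" if "x \<in> {P1, P2, P3}" for x
      using that by (intro eqc_base) (auto simp: adjacent_def P)
    show "(x, Q1) \<in> eqc (adjacent \<lparr>crossings = {Q1, Q2, Q3} \<union> K, circles = n\<rparr>)" if "x \<in> {Q1, Q2, Q3}" for x
      using that by (intro eqc_base) (auto simp: adjacent_def Q)
  qed (use notin in auto)
  have "link_diagram D'"
    by (rule link_diagram') (use D regs comps proper proper' in \<open>auto simp: regions_eq D_def P\<close>)
  then show ?thesis
    by (simp add: D'_def Q)
qed

section \<open>Planarity of first moves\<close>

text \<open>A curl on the arc \<open>c\<close> adds one crossing, two arcs and one region, the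
  monogon, and 1 - 2 + 1 = 0.\<close>

lemma link_diagram_R1:
  fixes K :: "'a crossing set"
  assumes X: "Xing c d e f \<notin> K" "c \<notin> {d, e, f}"
    and ab: "a \<noteq> b" "{a, b} \<inter> {c, d, e, f} = {}" "{a, b} \<inter> labels K = {}"
    and D: "link_diagram \<lparr>crossings = insert (Xing c d e f) K, circles = n\<rparr>"
  shows "link_diagram \<lparr>crossings = {Xing a a b c, Xing b d e f} \<union> K, circles = n\<rparr>"
proof -
  define X X' Y where X_def: "X = Xing c d e f" "X' = Xing b d e f" "Y = Xing a a b c"
  define D1 where "D1 = \<lparr>crossings = insert X K, circles = n\<rparr>"
  define D2 where "D2 = \<lparr>crossings = insert Y (insert X' K), circles = n\<rparr>"
  let ?K = "ends \<lparr>crossings = K, circles = n\<rparr>"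
  have notin: "X \<notin> K" "X' \<notin> K" "Y \<notin> K" and neq: "X' \<noteq> Y" "Y \<noteq> X'" "X \<noteq> Y" "Y \<noteq> X" "X \<noteq> X'" "X' \<noteq> X"
    using X ab by (force simp: X_def labels_def)+
  have arcs: "arc_of (X, 0) = c" "arc_of (X, 1) = d" "arc_of (X, 2) = e" "arc_of (X, 3) = f"
    "arc_of (X', 0) = b" "arc_of (X', 1) = d" "arc_of (X', 2) = e" "arc_of (X', 3) = f"
    "arc_of (Y, 0) = a" "arc_of (Y, 1) = a" "arc_of (Y, 2) = b" "arc_of (Y, 3) = c"
    by (simp_all add: X_def arc_of_def)
  have ends1: "ends D1 = {(X, 0), (X, 1), (X, 2), (X, 3)} \<union> ?K"
    by (simp add: D1_def ends_insert)
  have ends2: "ends D2 = {(Y, 0), (Y, 1), (Y, 2), (Y, 3), (X', 0), (X', 1), (X', 2), (X', 3)} \<union> ?K"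
    by (simp add: D2_def ends_insert) blast
  have lab: "labels (crossings D2) = insert a (insert b (labels (crossings D1)))"
    by (auto simp: D1_def D2_def X_def labels_def)
  have ab1: "a \<notin> labels (crossings D1)" "b \<notin> labels (crossings D1)"
    using ab by (auto simp: D1_def X_def labels_def)
  have p1: "proper D1"
    using D by (simp add: link_diagram_iff D1_def X_def)
  have fin: "finite K"
    using p1 by (simp add: proper_def D1_def)
  define p where "p = patch [((X, 0), (X', 0)), ((X, 1), (X', 1)), ((X, 2), (X', 2)), ((X, 3), (X', 3 :: nat))]"
  \<comment> \<open>The corner \<open>(Y, 0)\<close> is the monogon. The other three corners of the
    curl lie on the two sides of the arc \<open>c\<close>: those at 1 and 3 in the region of
    \<open>(X, 0)\<close>, the one at 2 in that of \<open>(X, 3)\<close>.\<close>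
  define q where "q = patch [((X', 0), (X, 0)), ((X', 1), (X, 1)), ((X', 2), (X, 2)), ((X', 3), (X, 3)),
    ((Y, 1), (X, 0)), ((Y, 3), (X, 0)), ((Y, 2), (X, 3 :: nat))]"
  note tables = p_def q_def patch_def neq
  have K: "p h = h" "q h = h" "prev_end h \<in> ?K" "arc_of h \<noteq> a" "arc_of h \<noteq> b" "fst h \<in> K"
    if "h \<in> ?K" for h
    using that notin ab(3) arc_of_in_labels[OF that]
    by (auto simp: p_def q_def ends_def prev_end_def intro!: patch_outside)
  have pX: "p (X, 0) = (X', 0)" "p (X, 1) = (X', 1)" "p (X, 2) = (X', 2)" "p (X, 3) = (X', 3)"
    and qX: "q (X', 0) = (X, 0)" "q (X', 1) = (X, 1)" "q (X', 2) = (X, 2)" "q (X', 3) = (X, 3)"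
      "q (Y, 0) = (Y, 0)" "q (Y, 1) = (X, 0)" "q (Y, 2) = (X, 3)" "q (Y, 3) = (X, 0)"
    by (simp_all add: tables)
  have p_in: "p h \<in> ends D2 - {(Y, 0)}" if "h \<in> ends D1" for h
    using that notin K[of h] unfolding ends1 ends2 by (auto simp: pX[simplified] neq)
  have qp: "q (p h) = h" if "h \<in> ends D1" for h
    using that K[of h] unfolding ends1 by (auto simp: pX[simplified] qX[simplified])
  have p_arc: "arc_of (p h) = arc_of h" if "h \<in> ends D1" "h \<noteq> (X, 0)" for h
    using that K[of h] unfolding ends1 by (auto simp: pX[simplified] arcs[simplified])
  have p_prev: "p (prev_end h) = prev_end (p h)" if "h \<in> ends D1" for h
    using that[unfolded ends1]
  proof
    assume "h \<in> ?K"
    then show ?thesis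
      by (simp add: K)
  qed (elim insertE emptyE, simp_all add: pX[simplified] prev_end_def)
  have inj_p: "inj_on p (ends D1)"
    using qp by (rule inj_on_inverseI)
  have p2: "proper D2"
    unfolding proper_def
  proof (intro conjI ballI)
    show "finite (crossings D2)"
      using fin by (simp add: D2_def)
    fix l assume "l \<in> labels (crossings D2)"
    \<comment> \<open>The new arcs have both ends at \<open>Y\<close> and \<open>X'\<close>, the arc
      \<open>c\<close> trades its end at \<open>X\<close> for one at \<open>Y\<close>, and all other
      arcs follow \<open>p\<close>.\<close>
    then consider "l = a" | "l = b" | "l = c" | "l \<in> labels (crossings D1)" "l \<notin> {a, b, c}"
      unfolding lab by blast
    then show "card {h \<in> ends D2. arc_of h = l} = 2"
    proof cases
      case 1
      have "h \<in> ends D2 \<and> arc_of h = a \<longleftrightarrow> h = (Y, 0) \<or> h = (Y, 1)" for h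
      proof (cases "h \<in> ?K")
        case True
        then show ?thesis
          using K(4,6)[OF True] notin by auto
      next
        case False
        then show ?thesis
          using ab unfolding ends2 by (auto simp: arcs[simplified])
      qed
      then have "{h \<in> ends D2. arc_of h = a} = {(Y, 0), (Y, 1)}"
        by auto
      then show ?thesis
        using 1 by simp
    next
      case 2
      have "h \<in> ends D2 \<and> arc_of h = b \<longleftrightarrow> h = (Y, 2) \<or> h = (X', 0)" for h
      proof (cases "h \<in> ?K")
        case True
        then show ?thesis
          using K(5,6)[OF True] notin by auto
      next
        case False
        then show ?thesis
          using ab unfolding ends2 by (auto simp: arcs[simplified])
      qed
      then have "{h \<in> ends D2. arc_of h = b} = {(Y, 2), (X', 0)}"
        by auto
      then show ?thesis
        using 2 neq by simp
    next
      case 3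
      have 1: "{h \<in> ends D1. arc_of h = c} = insert (X, 0) {h \<in> ?K. arc_of h = c}"
        using X(2) unfolding ends1 by (auto simp: arcs[simplified])
      have 2: "{h \<in> ends D2. arc_of h = c} = insert (Y, 3) {h \<in> ?K. arc_of h = c}"
        using X(2) ab(2) unfolding ends2 by (auto simp: arcs[simplified])
      have "finite {h \<in> ?K. arc_of h = c}"
        using fin finite_ends[of "\<lparr>crossings = K, circles = n\<rparr>"] by simp
      moreover have "(X, 0) \<notin> ?K" "(Y, 3) \<notin> ?K"
        using notin by (auto simp: ends_def)
      ultimately have "card {h \<in> ends D2. arc_of h = c} = card {h \<in> ends D1. arc_of h = c}"
        unfolding 1 2 by simp
      moreover have "c \<in> labels (crossings D1)"
        by (simp add: D1_def X_def labels_def)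
      ultimately show ?thesis
        using p1 3 by (simp add: proper_def)
    next
      case 4
      have "{h \<in> ends D2. arc_of h = l} = p ` {h \<in> ends D1. arc_of h = l}"
      proof
        show "p ` {h \<in> ends D1. arc_of h = l} \<subseteq> {h \<in> ends D2. arc_of h = l}"
        proof
          fix h assume "h \<in> p ` {h \<in> ends D1. arc_of h = l}"
          then obtain k where "h = p k" "k \<in> ends D1" "arc_of k = l" "k \<noteq> (X, 0)"
            using 4(2) arcs(1) by auto
          then show "h \<in> {h \<in> ends D2. arc_of h = l}"
            using p_in p_arc by auto
        qed
        show "{h \<in> ends D2. arc_of h = l} \<subseteq> p ` {h \<in> ends D1. arc_of h = l}"
        proof
          fix h assume h: "h \<in> {h \<in> ends D2. arc_of h = l}"
          then consider "h \<in> ?K" | "h \<in> {(X', 1), (X', 2), (X', 3)}"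
            using 4(2) unfolding ends2 by (auto simp: arcs[simplified])
          then show "h \<in> p ` {h \<in> ends D1. arc_of h = l}"
          proof cases
            case 1
            then have "h = p h" "h \<in> {h \<in> ends D1. arc_of h = l}"
              using K h by (auto simp: ends1)
            then show ?thesis
              by (rule image_eqI)
          next
            case 2
            then have "h = p (X, snd h)" "(X, snd h) \<in> {h \<in> ends D1. arc_of h = l}"
              using h by (auto simp: ends1 pX[simplified] arcs[simplified])
            then show ?thesis
              by (rule image_eqI)
          qed
        qed
      qed
      moreover have "inj_on p {h \<in> ends D1. arc_of h = l}"
        using inj_p by (rule inj_on_subset) auto
      ultimately show ?thesis
        using p1 4(1) by (simp add: proper_def card_image)
    qed
  qed
  \<comment> \<open>The far end of the arc carrying the curl; by \<open>c \<notin> {d, e, f}\<close>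
    it is not at \<open>X\<close>, so \<open>p\<close> and \<open>q\<close> fix it.\<close>
  define u where "u = other_end D1 (X, 0)"
  have X0: "(X, 0) \<in> ends D1"
    by (simp add: ends1)
  have u: "u \<in> ?K" "arc_of u = c" "other_end D1 u = (X, 0)"
  proof -
    show "arc_of u = c" "other_end D1 u = (X, 0)"
      using arc_of_other_end[OF p1 X0] other_end_other_end[OF p1 X0] by (simp_all add: u_def arcs)
    then show "u \<in> ?K"
      using other_end_in[OF p1 X0, folded u_def] other_end_neq[OF p1 X0, folded u_def] X(2)
      by (auto simp: ends1 arcs[simplified])
  qed
  note rel = region_relI[OF p2, unfolded ends2]
  have Y: "(Y, 0) \<noteq> u" "(Y, 3) \<noteq> u" "(X, 0) \<noteq> u"
    using u(1) notin by (auto simp: ends_def)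
  have r: "((Y, 1), (Y, 3)) \<in> eqc (region_rel D2)" "((X', 0), (Y, 1)) \<in> eqc (region_rel D2)"
    "((Y, 2), (X', 3)) \<in> eqc (region_rel D2)" "(u, (Y, 2)) \<in> eqc (region_rel D2)"
    "((Y, 3), prev_end u) \<in> eqc (region_rel D2)"
    using rel[of "(Y, 0)" "(Y, 1)"] rel[of "(Y, 2)" "(X', 0)"] rel[of "(X', 0)" "(Y, 2)"]
      rel[of "(Y, 3)" u] rel[of u "(Y, 3)"] u Y
    by (simp_all add: neq arcs[simplified] prev_end_def)
  have oth2: "other_end D2 (Y, 0) = (Y, 1)" "other_end D2 (Y, 1) = (Y, 0)" "other_end D2 (Y, 2) = (X', 0)"
    "other_end D2 (X', 0) = (Y, 2)" "other_end D2 (Y, 3) = u" "other_end D2 u = (Y, 3)"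
    by (rule other_end_eqI[OF p2]; use u Y in \<open>simp add: ends2 neq arcs[simplified]\<close>)+
  have oth: "other_end D2 (p h) = p (other_end D1 h)" if h: "h \<in> ends D1" "h \<noteq> (X, 0)" "h \<noteq> u" for h
  proof (rule other_end_eqI[OF p2])
    have o: "other_end D1 h \<in> ends D1"
      using other_end_in[OF p1 h(1)] .
    moreover have "other_end D1 h \<noteq> (X, 0)"
      using h other_end_other_end[OF p1 h(1)] by (auto simp: u_def)
    ultimately show "arc_of (p (other_end D1 h)) = arc_of (p h)"
      using p_arc h arc_of_other_end[OF p1 h(1)] by simp
    show "p (other_end D1 h) \<noteq> p h"
      using inj_onD[OF inj_p _ o h(1)] other_end_neq[OF p1 h(1)] by blast
    show "p h \<in> ends D2" "p (other_end D1 h) \<in> ends D2"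
      using p_in h o by auto
  qed
  have regs: "card (ends D1 // eqc (region_rel D1)) = card ((ends D2 - {(Y, 0)}) // eqc (region_rel D2))"
  proof (rule card_quotient_eqc[of _ p _ q])
    show "(p x, p y) \<in> eqc (region_rel D2)" if xy: "(x, y) \<in> region_rel D1" for x y
    proof -
      obtain h where h: "x = other_end D1 h" "y = prev_end h" "h \<in> ends D1"
        using xy by (auto simp: region_rel_def)
      consider "h = (X, 0)" | "h = u" | "h \<noteq> (X, 0)" "h \<noteq> u"
        by blast
      then show ?thesis
      proof cases
        case 1
        then have "p x = u" "p y = (X', 3)"
          using h K(1)[OF u(1)] by (simp_all add: u_def prev_end_def pX)
        then show ?thesis
          using r eqc_trans by metis
      next
        case 2
        then have "p x = (X', 0)" "p y = prev_end u"
          using h u K(1) K(3) by (simp_all add: pX)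
        then show ?thesis
          using r eqc_trans by metis
      next
        case 3
        then have "p x = other_end D2 (p h)" "p y = prev_end (p h)" "p h \<in> ends D2"
          using h oth p_prev p_in by auto
        then show ?thesis
          unfolding region_rel_def by (intro eqc_base) blast
      qed
    qed
    show "(q x, q y) \<in> eqc (region_rel D1)" if xy: "(x, y) \<in> region_rel D2" for x y
    proof -
      obtain h where h: "x = other_end D2 h" "y = prev_end h" "h \<in> ends D2"
        using xy by (auto simp: region_rel_def)
      have "h \<in> {(Y, 0), (Y, 1), (Y, 2), (Y, 3)} \<or> h \<in> p ` ends D1"
      proof -
        have "h \<in> p ` ends D1" if "h \<in> ?K"
          using K(1)[OF that] that by (metis UnCI ends1 image_eqI)
        then show ?thesis
          using h(3) pX[symmetric] unfolding ends1 ends2 by auto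
      qed
      then consider "h = (Y, 3)" | "h = u" | "h \<in> {(Y, 0), (Y, 1), (Y, 2), (X', 0)}"
        | k where "h = p k" "k \<in> ends D1" "k \<noteq> (X, 0)" "k \<noteq> u"
        using pX(1) K(1)[OF u(1)] by blast
      then show ?thesis
      proof cases
        case 1
        then have "q x = other_end D1 (X, 0)" "q y = prev_end (X, 0)"
          using h oth2 K(2)[OF u(1)] qX by (simp_all add: u_def prev_end_def)
        then show ?thesis
          using X0 unfolding region_rel_def by (intro eqc_base) blast
      next
        case 2
        then have "q x = other_end D1 u" "q y = prev_end u"
          using h oth2 K(2,3) u qX by simp_all
        moreover have "u \<in> ends D1"
          using u(1) by (simp add: ends1)
        ultimately show ?thesis
          unfolding region_rel_def by (intro eqc_base) blast
      next
        case 3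
        then have "q x = q y"
          using h by (auto simp: oth2[simplified] qX[simplified] prev_end_def)
        then show ?thesis
          by simp
      next
        case 4
        then have "q x = other_end D1 k" "q y = prev_end k"
          using h oth p_prev[symmetric] qp other_end_in[OF p1]
          by (auto simp: ends_def prev_end_def)
        then show ?thesis
          using 4 unfolding region_rel_def by (intro eqc_base) blast
      qed
    qed
    show "q y \<in> ends D1" if "y \<in> ends D2 - {(Y, 0)}" for y
      using that K[of y] unfolding ends1 ends2 by (auto simp: qX[simplified])
    show "(p (q y), y) \<in> eqc (region_rel D2)" if "y \<in> ends D2 - {(Y, 0)}" for y
    proof -
      have "((X', 0), (Y, 3)) \<in> eqc (region_rel D2)"
        using r(2,1) by (rule eqc_trans)
      then show ?thesis
        using that r(2) r(3)[THEN eqc_sym] K[of y] unfolding ends2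
        by (auto simp: pX[simplified] qX[simplified])
    qed
  qed (use p_in qp in auto)
  have "(ends D2 // eqc (region_rel D2))
      = insert (eqc (region_rel D2) `` {(Y, 0)}) ((ends D2 - {(Y, 0)}) // eqc (region_rel D2))"
  proof -
    have "(Y, 0) \<in> ends D2"
      by (simp add: ends2)
    then show ?thesis
      unfolding quotient_def by blast
  qed
  moreover have "eqc (region_rel D2) `` {(Y, 0)} \<notin> (ends D2 - {(Y, 0)}) // eqc (region_rel D2)"
  proof
    assume "eqc (region_rel D2) `` {(Y, 0)} \<in> (ends D2 - {(Y, 0)}) // eqc (region_rel D2)"
    then obtain h where "h \<noteq> (Y, 0)" "eqc (region_rel D2) `` {(Y, 0)} = eqc (region_rel D2) `` {h}"
      unfolding quotient_image by blast
    then have h: "h \<noteq> (Y, 0)" "((Y, 0), h) \<in> eqc (region_rel D2)"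
      unfolding eqc_Image_eq_iff .
    \<comment> \<open>The only pair that touches \<open>(Y, 0)\<close> comes from the end
      \<open>(Y, 1)\<close> and relates \<open>(Y, 0)\<close> to itself, so the monogon is a class
      of its own.\<close>
    have "z = (Y, 0)" if xz: "(x, z) \<in> region_rel D2 \<union> (region_rel D2)\<inverse>" "x = (Y, 0)" for x z
    proof -
      have "h' = (Y, 1)" if "h' \<in> ends D2" "other_end D2 h' = (Y, 0) \<or> prev_end h' = (Y, 0)" for h'
      proof -
        have "h' = (Y, 1)" if "prev_end h' = (Y, 0)"
          using \<open>h' \<in> ends D2\<close> that by (cases h') (auto simp: prev_end_def ends_def less_4_iff)
        then show ?thesis
          using that other_end_other_end[OF p2, of h'] oth2(1) by metis
      qed
      moreover obtain h' where "h' \<in> ends D2"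
        "x = other_end D2 h' \<and> z = prev_end h' \<or> z = other_end D2 h' \<and> x = prev_end h'"
        using xz(1) unfolding region_rel_def by blast
      ultimately have "x = other_end D2 (Y, 1) \<and> z = prev_end (Y, 1) \<or> z = other_end D2 (Y, 1) \<and> x = prev_end (Y, 1)"
        using xz(2) by metis
      then show ?thesis
        unfolding oth2(2) by (auto simp: prev_end_def)
    qed
    with h(2) have "h = (Y, 0)"
      unfolding eqc_def by (induction rule: rtrancl_induct) auto
    with h(1) show False ..
  qed
  moreover have "finite ((ends D2 - {(Y, 0)}) // eqc (region_rel D2))"
    using p2 by (simp add: quotient_image proper_def finite_ends)
  ultimately have regs2: "card (regions D2) = Suc (card (regions D1))"
    by (simp add: regions_eq p1 p2 regs)
  have comps: "card (components \<lparr>crossings = {X} \<union> K, circles = n\<rparr>)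
      = card (components \<lparr>crossings = {Y, X'} \<union> K, circles = n\<rparr>)"
  proof (rule components_block[of _ _ _ X Y])
    show "labels {X} \<inter> labels K = labels {Y, X'} \<inter> labels K"
      using ab by (auto simp: labels_def X_def)
    show "(x, Y) \<in> eqc (adjacent \<lparr>crossings = {Y, X'} \<union> K, circles = n\<rparr>)" if "x \<in> {Y, X'}" for x
      using that by (intro eqc_base) (auto simp: adjacent_def X_def)
  qed (use notin in auto)
  have "link_diagram D2"
  proof -
    have "finite (labels (crossings D1))"
      using p1 by (simp add: labels_eq_arc_of proper_def finite_ends)
    then have "card (labels (crossings D2)) = card (labels (crossings D1)) + 2"
      using ab1 ab(1) by (simp add: lab)
    moreover have "card (crossings D2) = Suc (card (crossings D1))"
      using notin neq fin by (simp add: D1_def D2_def)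
    moreover have "link_diagram D1"
      using D by (simp add: D1_def X_def)
    ultimately show ?thesis
      using p2 regs2 comps by (simp add: link_diagram_iff D1_def D2_def)
  qed
  then show ?thesis
    by (simp add: D2_def X_def)
qed

section \<open>Untwisting a band\<close>

text \<open>The overstrand runs from \<open>L j\<close> to \<open>R (Suc j)\<close>. Of the two ways
  to list the crossing, this is the one that occurs in \<open>R3\<close>.\<close>

definition band :: "(nat \<Rightarrow> 'a) \<Rightarrow> (nat \<Rightarrow> 'a) \<Rightarrow> nat \<Rightarrow> 'a crossing" where
  "band L R j = Xing (L (Suc j)) (L j) (R j) (R (Suc j))"

text \<open>Formally this is crossing \<open>Suc j\<close> of a band with its sides exchanged. The
  arc \<open>L (j + 2)\<close>, on the understrand of \<open>band L R (Suc j)\<close>, is now on the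
  overstrand; for the arc \<open>L (Suc m)\<close> leaving the band this restores
  alternation.\<close>

definition unband :: "(nat \<Rightarrow> 'a) \<Rightarrow> (nat \<Rightarrow> 'a) \<Rightarrow> nat \<Rightarrow> 'a crossing" where
  "unband L R j = Xing (R (j + 2)) (R (Suc j)) (L (Suc j)) (L (j + 2))"

text \<open>
  The band before the \<open>k\<close>-th last third move: \<open>k\<close> crossings of the original band, then the two
  crossings at which the strand with ends \<open>R (Suc m)\<close>, \<open>v\<close> and middle part \<open>u\<close> passes over it, then the
  crossings that have already been turned.  Each third move reuses the label \<open>R (Suc j)\<close> on the left and
  \<open>L (Suc j)\<close> on the right of the turned part, so no new labels are needed.
\<close>

definition untwisting ::
    "(nat \<Rightarrow> 'a) \<Rightarrow> (nat \<Rightarrow> 'a) \<Rightarrow> 'a \<Rightarrow> 'a \<Rightarrow> nat \<Rightarrow> nat \<Rightarrow> 'a crossing set" where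
  "untwisting L R u v m k = band L R ` {..<k} \<union> unband L R ` {k..<m} \<union>
     {Xing (R (Suc k)) (R (Suc m)) (L k) u, Xing (L (Suc k)) u (R k) v}"

lemma map_crossing_upd_fresh: "b \<notin> set_crossing x \<Longrightarrow> map_crossing (id(b := c)) x = x"
  by (cases x) auto

text \<open>The band has \<open>Suc m\<close> crossings. The labels \<open>L m\<close> and
  \<open>R (Suc m)\<close> are new, for a piece of the arc \<open>u\<close> cut by the curl and for
  the loop of the curl; the original arcs at these two places are \<open>u\<close> and
  \<open>v\<close>. Only \<open>L 0\<close>, \<open>R 0\<close>, \<open>L (Suc m)\<close> and
  \<open>v\<close> lead to \<open>K\<close>.\<close>

locale twisted_band =
  fixes K :: "'a crossing set" and L R :: "nat \<Rightarrow> 'a" and u v :: 'a and m :: nat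
  assumes m: "0 < m"
    and L_eq: "\<And>i j. i \<le> Suc m \<Longrightarrow> j \<le> Suc m \<Longrightarrow> L i = L j \<longleftrightarrow> i = j"
    and R_eq: "\<And>i j. i \<le> Suc m \<Longrightarrow> j \<le> Suc m \<Longrightarrow> R i = R j \<longleftrightarrow> i = j"
    and LR: "\<And>i j. i \<le> Suc m \<Longrightarrow> j \<le> Suc m \<Longrightarrow> L i \<noteq> R j"
    and u: "\<And>i. i \<le> Suc m \<Longrightarrow> u \<noteq> L i \<and> u \<noteq> R i" "u \<noteq> v"
    and v: "\<And>i. i \<le> Suc m \<Longrightarrow> v \<noteq> L i \<and> v \<noteq> R i"
    and K: "u \<notin> labels K" "\<And>i. 0 < i \<Longrightarrow> i \<le> m \<Longrightarrow> L i \<notin> labels K"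
      "\<And>i. 0 < i \<Longrightarrow> i \<le> Suc m \<Longrightarrow> R i \<notin> labels K"
begin

lemma RL: "i \<le> Suc m \<Longrightarrow> j \<le> Suc m \<Longrightarrow> R i \<noteq> L j"
  using LR[of j i] by simp

lemma u': "i \<le> Suc m \<Longrightarrow> L i \<noteq> u \<and> R i \<noteq> u"
  using u(1)[of i] by auto

lemma v': "i \<le> Suc m \<Longrightarrow> L i \<noteq> v \<and> R i \<noteq> v"
  using v(1)[of i] by auto

lemmas distinct_labels = L_eq R_eq LR RL u u' v v' u(2)[symmetric]

text \<open>The strand through \<open>v\<close>, \<open>u\<close> and \<open>R (Suc m)\<close> is
  the top strand of a third move past crossing \<open>k\<close>. In the first move,
  \<open>Suc k = m\<close>, two outer arcs are both \<open>R (Suc m)\<close>, the loop of the curl;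
  this is why coinciding outer labels must be allowed.\<close>

lemma untwisting_step:
  assumes k: "k < m" and D: "link_diagram \<lparr>crossings = untwisting L R u v m (Suc k) \<union> K, circles = n\<rparr>"
  shows "diagram_step \<lparr>crossings = untwisting L R u v m (Suc k) \<union> K, circles = n\<rparr>
    \<lparr>crossings = untwisting L R u v m k \<union> K, circles = n\<rparr>"
proof -
  let ?R = "band L R ` {..<k} \<union> unband L R ` {Suc k..<m} \<union> K"
  have src: "untwisting L R u v m (Suc k) \<union> K =
      {Xing (L (k + 2)) u (R (Suc k)) v, Xing (R (k + 2)) (R (Suc m)) (L (Suc k)) u,
       Xing (L (Suc k)) (L k) (R k) (R (Suc k))} \<union> ?R"
    by (auto simp: untwisting_def lessThan_Suc band_def)
  have "{k..<m} = insert k {Suc k..<m}"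
    using k by auto
  then have tgt: "untwisting L R u v m k \<union> K =
      {Xing (R (Suc k)) (R (Suc m)) (L k) u, Xing (L (Suc k)) u (R k) v,
       Xing (R (k + 2)) (R (Suc k)) (L (Suc k)) (L (k + 2))} \<union> ?R"
    by (auto simp: untwisting_def unband_def)
  have tmb: "distinct [u, R (Suc k), L (Suc k)]" "{u, R (Suc k), L (Suc k)} \<inter> labels ?R = {}"
    "{u, R (Suc k), L (Suc k)} \<inter> {v, L (k + 2), R (k + 2), R (Suc m), L k, R k} = {}"
    using k K by (auto simp: labels_def band_def unband_def distinct_labels)
  have "link_diagram \<lparr>crossings = untwisting L R u v m k \<union> K, circles = n\<rparr>"
    unfolding tgt using D[unfolded src] by (rule link_diagram_R3[OF tmb])
  moreover have "reidemeister \<lparr>crossings = untwisting L R u v m (Suc k) \<union> K, circles = n\<rparr>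
    \<lparr>crossings = untwisting L R u v m k \<union> K, circles = n\<rparr>"
    unfolding src tgt by (rule R3[OF tmb])
  ultimately show ?thesis
    using D by (simp add: diagram_step_def)
qed

text \<open>The induction counts the moves made. Planarity is carried along because each step
  presupposes it of its source.\<close>

lemma untwisting_steps:
  assumes "link_diagram \<lparr>crossings = untwisting L R u v m m \<union> K, circles = n\<rparr>" "k \<le> m"
  shows "link_diagram \<lparr>crossings = untwisting L R u v m (m - k) \<union> K, circles = n\<rparr> \<and>
    equivclp diagram_step \<lparr>crossings = untwisting L R u v m m \<union> K, circles = n\<rparr>
      \<lparr>crossings = untwisting L R u v m (m - k) \<union> K, circles = n\<rparr>"
  using assms(2)
proof (induction k)
  case 0
  then show ?case
    using assms(1) by simp
next
  case (Suc k)
  have "Suc (m - Suc k) = m - k"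
    using Suc.prems by simp
  then have "diagram_step \<lparr>crossings = untwisting L R u v m (m - k) \<union> K, circles = n\<rparr>
    \<lparr>crossings = untwisting L R u v m (m - Suc k) \<union> K, circles = n\<rparr>"
    using untwisting_step[of "m - Suc k" n] Suc by simp
  then show ?case
    using Suc by (meson Suc_leD diagram_step_def equivclp_into_equivclp)
qed

text \<open>The first move is used backwards: \<open>untwisting L R u v m m\<close> is the band with
  a curl on the arc \<open>u\<close>, and removing the curl gives the original band.\<close>

lemma untwist_band:
  assumes D: "link_diagram
    \<lparr>crossings = band (L(m := u)) (R(Suc m := v)) ` {..<Suc m} \<union> K, circles = n\<rparr>" (is "link_diagram ?D")
  shows "link_diagram \<lparr>crossings = untwisting L R u v m 0 \<union> K, circles = n\<rparr>"
    and "equivclp diagram_step ?D \<lparr>crossings = untwisting L R u v m 0 \<union> K, circles = n\<rparr>"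
proof -
  \<comment> \<open>The arc \<open>u\<close> joins the crossings \<open>l\<close> and
    \<open>m\<close> of the band. The curl cuts it, and the piece at crossing \<open>l\<close> gets
    the label \<open>L m\<close>, which turns \<open>?X\<close> into \<open>?X'\<close>.\<close>
  obtain l where l: "m = Suc l"
    using m by (cases m) auto
  let ?R = "band L R ` {..<l} \<union> {Xing (L (Suc m)) u (R m) v} \<union> K"
  let ?X = "Xing u (L l) (R l) (R m)" and ?X' = "Xing (L m) (L l) (R l) (R m)"
  have "band (L(m := u)) (R(Suc m := v)) ` {..<l} = band L R ` {..<l}"
    by (rule image_cong) (auto simp: band_def l)
  then have src: "?D = \<lparr>crossings = insert ?X ?R, circles = n\<rparr>"
    by (auto simp: lessThan_Suc l band_def)
  have tgt: "untwisting L R u v m m \<union> K =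
      {Xing (R (Suc m)) (R (Suc m)) (L m) u, ?X'} \<union> ?R"
    by (auto simp: untwisting_def l lessThan_Suc band_def)
  have fresh: "L m \<notin> labels ?R" "R (Suc m) \<notin> labels ?R"
    using K l by (auto simp: labels_def band_def distinct_labels)
  have X: "?X \<notin> ?R"
    using K by (auto simp: labels_def band_def distinct_labels l)
  have D2: "link_diagram \<lparr>crossings = untwisting L R u v m m \<union> K, circles = n\<rparr>"
    unfolding tgt
    by (rule link_diagram_R1) (use X fresh D[unfolded src] in \<open>auto simp: distinct_labels l\<close>)
  have "R (Suc m) \<notin> labels (insert ?X' ?R)" "R (Suc m) \<notin> {L m, u}"
    using fresh by (auto simp: labels_def distinct_labels l)
  note R1 = R1[OF this, of n]
  have join: "join [(L m, u)] \<lparr>crossings = insert ?X' ?R, circles = n\<rparr> = ?D"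
  proof -
    have "map_crossing (id(L m := u)) ` ?R = id ` ?R"
      using fresh(1) by (intro image_cong) (auto simp: labels_def map_crossing_upd_fresh)
    then show ?thesis
      unfolding src by (simp add: Let_def distinct_labels l image_Un)
  qed
  have "untwisting L R u v m m \<union> K = insert (Xing (R (Suc m)) (R (Suc m)) (L m) u) (insert ?X' ?R)"
    unfolding tgt by auto
  then have "reidemeister \<lparr>crossings = untwisting L R u v m m \<union> K, circles = n\<rparr> ?D"
    using R1 unfolding join by simp
  then have "diagram_step \<lparr>crossings = untwisting L R u v m m \<union> K, circles = n\<rparr> ?D"
    using D D2 unfolding diagram_step_def by blast
  then show "link_diagram \<lparr>crossings = untwisting L R u v m 0 \<union> K, circles = n\<rparr>"
    "equivclp diagram_step ?D \<lparr>crossings = untwisting L R u v m 0 \<union> K, circles = n\<rparr>"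
    using untwisting_steps[OF D2, of m]
    by (auto intro: equivclp_trans[OF equivclp_sym[OF r_into_equivclp]])
qed

end

section \<open>Alternation as a parity condition\<close>

definition opposite_parity :: "'a crossing set \<Rightarrow> bool" where
  "opposite_parity K \<longleftrightarrow> (\<forall>x\<in>K. \<forall>y\<in>K. \<forall>i<4. \<forall>j<4.
     arc_at x i = arc_at y j \<longrightarrow> (x, i) \<noteq> (y, j) \<longrightarrow> odd i \<noteq> odd j)"

text \<open>Odd positions lie on the overstrand, so alternation means that the two ends of every arc
  differ in parity. Since \<open>opposite_parity\<close> speaks of sets of crossings, it can be
  checked on parts of a diagram.\<close>

lemma alternatingI:
  assumes "proper D" "opposite_parity (crossings D)"
  shows "alternating D"
  unfolding alternating_def
proof
  fix h assume h: "h \<in> ends D"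
  note o = other_end_in[OF assms(1) h] other_end_neq[OF assms(1) h] arc_of_other_end[OF assms(1) h]
  show "odd (snd h) \<longleftrightarrow> even (snd (other_end D h))"
    using assms(2) h o unfolding opposite_parity_def ends_def arc_of_def
    by (metis lessThan_iff mem_Times_iff prod.collapse)
qed

text \<open>The four positions shift by one and every arc stays in place. As the crossings form a
  set, \<open>change x\<close> has to be new in order not to merge with another crossing.\<close>

lemma proper_crossing_change:
  assumes "proper D" "x \<in> crossings D" "change x \<notin> crossings D"
  shows "proper (crossing_change x D)"
proof -
  let ?D = "crossing_change x D"
  define \<sigma> where "\<sigma> h = (if fst h = x then (change x, (snd h + 3) mod 4) else h)"
    for h :: "'a crossing \<times> nat"
  have cr: "crossings ?D = insert (change x) (crossings D - {x})"
    by (simp add: crossing_change_def)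
  have "bij_betw \<sigma> (ends D) (ends ?D)"
    by (rule bij_betw_byWitness[of _
          "\<lambda>h. if fst h = change x then (x, (snd h + 1) mod 4) else h"])
      (use assms in \<open>auto simp: \<sigma>_def ends_def cr less_4_iff split: if_splits\<close>)
  moreover have "arc_of (\<sigma> h) = arc_of h" if "h \<in> ends D" for h
    using that by (cases x) (auto simp: \<sigma>_def arc_of_def ends_def less_4_iff)
  ultimately interpret ends_bij D ?D \<sigma>
    using assms(1) by unfold_locales
  show ?thesis
    by (rule proper')
qed

context twisted_band
begin

text \<open>The crossing with overstrand from \<open>u\<close> to \<open>v\<close> is the one to
  change. Afterwards the block meets \<open>L 0\<close> and \<open>v\<close> at even positions,
  \<open>R 0\<close> and \<open>L (Suc m)\<close> at odd ones, opposite to \<open>K\<close>.\<close>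

lemma almost_alternating_untwisted:
  assumes D: "link_diagram \<lparr>crossings = untwisting L R u v m 0 \<union> K, circles = n\<rparr>"
    and par: "opposite_parity K"
    and odd: "\<And>x i. x \<in> K \<Longrightarrow> i < 4 \<Longrightarrow> arc_at x i \<in> {L 0, v} \<Longrightarrow> odd i"
    and even: "\<And>x i. x \<in> K \<Longrightarrow> i < 4 \<Longrightarrow> arc_at x i \<in> {R 0, L (Suc m)} \<Longrightarrow> even i"
  shows "almost_alternating \<lparr>crossings = untwisting L R u v m 0 \<union> K, circles = n\<rparr>"
proof -
  let ?D = "\<lparr>crossings = untwisting L R u v m 0 \<union> K, circles = n\<rparr>"
  let ?x = "Xing (L (Suc 0)) u (R 0) v"
  define B where "B = unband L R ` {..<m} \<union> {Xing (R (Suc 0)) (R (Suc m)) (L 0) u, Xing u (R 0) v (L (Suc 0))}"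
  have x: "?x \<in> crossings ?D" "change ?x \<notin> crossings ?D" "?x \<notin> K"
    using K(1) by (auto simp: untwisting_def labels_def unband_def distinct_labels)
  have "crossings (crossing_change ?x ?D) = B \<union> K"
    using x(3) by (auto simp: crossing_change_def untwisting_def B_def unband_def distinct_labels)
  moreover have "opposite_parity (B \<union> K)"
  proof -
    have unb: "arc_at (unband L R j) 0 = R (j + 2)" "arc_at (unband L R j) 1 = R (Suc j)"
      "arc_at (unband L R j) 2 = L (Suc j)" "arc_at (unband L R j) 3 = L (j + 2)" for j
      by (simp_all add: unband_def)
    \<comment> \<open>No label occurs at two even or at two odd positions of \<open>B\<close>, so a
      repeated label has one position of each parity.\<close>
    have even_inj: "x = y \<and> i = j" if "x \<in> B" "y \<in> B" "i \<in> {0, 2}" "j \<in> {0, 2}" "arc_at x i = arc_at y j" for x y i j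
      using that unfolding B_def
      by (elim UnE insertE emptyE imageE) (simp_all add: unb distinct_labels)
    have odd_inj: "x = y \<and> i = j" if "x \<in> B" "y \<in> B" "i \<in> {1, 3}" "j \<in> {1, 3}" "arc_at x i = arc_at y j" for x y i j
      using that unfolding B_def
      by (elim UnE insertE emptyE imageE) (simp_all add: unb[simplified] distinct_labels)
    have BB: "odd i \<noteq> odd j"
      if xy: "x \<in> B" "y \<in> B" "i < 4" "j < 4" "arc_at x i = arc_at y j" "(x, i) \<noteq> (y, j)" for x y i j
    proof
      assume "odd i = odd j"
      then have "i \<in> {0, 2} \<and> j \<in> {0, 2} \<or> i \<in> {1, 3} \<and> j \<in> {1, 3}"
        using xy(3,4) by (auto simp: less_4_iff)
      then show False
        using even_inj[OF xy(1,2) _ _ xy(5)] odd_inj[OF xy(1,2) _ _ xy(5)] xy(6) by blast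
    qed
    have BK: "odd i \<noteq> odd j"
      if xy: "x \<in> B" "y \<in> K" "i < 4" "j < 4" "arc_at x i = arc_at y j" for x y i j
    proof -
      have "arc_at y j \<in> labels K"
        using xy(2,4) arc_at_image[of y] unfolding labels_def by blast
      then have lab: "arc_at x i \<in> labels K"
        unfolding xy(5) .
      \<comment> \<open>Among the labels of the turned crossings only \<open>L (j + 2)\<close> can
        occur in \<open>K\<close>, and only at the end of the row, where
        \<open>Suc j = m\<close>.\<close>
      have notin: "u \<notin> labels K" "j < m \<Longrightarrow> L (Suc j) \<notin> labels K" "j < m \<Longrightarrow> R (Suc j) \<notin> labels K"
        "j < m \<Longrightarrow> R (Suc (Suc j)) \<notin> labels K" "R (Suc m) \<notin> labels K"
        "j < m \<Longrightarrow> L (Suc (Suc j)) \<in> labels K \<Longrightarrow> Suc j = m" for j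
        using K(1) K(2)[of "Suc j"] K(2)[of "Suc (Suc j)"] K(3)[of "Suc j"] K(3)[of "Suc (Suc j)"] K(3)[of "Suc m"]
        by auto (meson Suc_leI Suc_lessI)
      have "arc_at x i \<in> {L 0, v} \<and> even i \<or> arc_at x i \<in> {R 0, L (Suc m)} \<and> odd i"
      proof -
        consider j where "x = unband L R j" "j < m" | "x = Xing (R (Suc 0)) (R (Suc m)) (L 0) u"
          | "x = Xing u (R 0) v (L (Suc 0))"
          using xy(1) unfolding B_def by auto
        then show ?thesis
        proof cases
          case 1
          then show ?thesis
            using lab xy(3) notin(2-4)[of j] notin(6)[of j] unfolding less_4_iff
            by (elim disjE) (simp_all add: unb[simplified])
        next
          case 2
          then show ?thesis
            using lab xy(3) notin(1,5) notin(3)[of 0] m unfolding less_4_iff by (elim disjE) simp_all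
        next
          case 3
          then show ?thesis
            using lab xy(3) notin(1) notin(2)[of 0] m unfolding less_4_iff by (elim disjE) simp_all
        qed
      qed
      then show ?thesis
      proof
        assume "arc_at x i \<in> {L 0, v} \<and> even i"
        then show ?thesis
          using odd[OF xy(2,4)] unfolding xy(5) by blast
      next
        assume "arc_at x i \<in> {R 0, L (Suc m)} \<and> odd i"
        then show ?thesis
          using even[OF xy(2,4)] unfolding xy(5) by blast
      qed
    qed
    show ?thesis
      unfolding opposite_parity_def
    proof (intro ballI allI impI)
      fix x y i j
      assume xy: "x \<in> B \<union> K" "y \<in> B \<union> K" "i < 4" "j < 4" "arc_at x i = arc_at y j" "(x, i) \<noteq> (y, j)"
      then consider "x \<in> B" "y \<in> B" | "x \<in> B" "y \<in> K" | "x \<in> K" "y \<in> B" | "x \<in> K" "y \<in> K"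
        by blast
      then show "odd i \<noteq> odd j"
      proof cases
        case 1
        then show ?thesis
          using xy by (intro BB)
      next
        case 2
        then show ?thesis
          using xy by (intro BK)
      next
        case 3
        then show ?thesis
          using BK[of y x j i] xy by metis
      next
        case 4
        then show ?thesis
          using par xy unfolding opposite_parity_def by blast
      qed
    qed
  qed
  moreover have "proper (crossing_change ?x ?D)"
    using x D by (intro proper_crossing_change) (auto simp: link_diagram_iff)
  ultimately have "alternating (crossing_change ?x ?D)"
    by (intro alternatingI) simp_all
  then show ?thesis
    using D x(1) unfolding almost_alternating_def by blast
qed

end

section \<open>The band of the negative edge\<close>

lemma arc_at_map_crossing: "i < 4 \<Longrightarrow> arc_at (map_crossing f x) i = f (arc_at x i)"
  by (cases x) (auto simp: less_4_iff)

lemma arc_at_in_set_crossing: "i < 4 \<Longrightarrow> arc_at x i \<in> set_crossing x"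
  using arc_at_image[of x] by blast

lemma half_turn_half_turn [simp]: "half_turn (half_turn x) = x"
  by (cases x) simp

lemma set_crossing_half_turn [simp]: "set_crossing (half_turn x) = set_crossing x"
  by (cases x) auto

lemma half_turn_map_crossing: "half_turn (map_crossing f x) = map_crossing f (half_turn x)"
  by (cases x) simp

lemma map_crossing_inj_on:
  assumes "inj_on f A" "set_crossing x \<subseteq> A" "set_crossing y \<subseteq> A" "map_crossing f x = map_crossing f y"
  shows "x = y"
  using assms by (cases x; cases y) (auto simp: inj_on_def)

lemma opposite_parity_map:
  assumes "opposite_parity K" "inj_on f (labels K)"
  shows "opposite_parity (map_crossing f ` K)"
  unfolding opposite_parity_def
proof (intro ballI allI impI)
  fix x' y' i j
  assume "x' \<in> map_crossing f ` K" "y' \<in> map_crossing f ` K" "i < 4" "j < 4"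
    "arc_at x' i = arc_at y' j" "(x', i) \<noteq> (y', j)"
  then obtain x y where xy: "x \<in> K" "y \<in> K" "i < 4" "j < 4" "(map_crossing f x, i) \<noteq> (map_crossing f y, j)"
    "arc_at (map_crossing f x) i = arc_at (map_crossing f y) j"
    by blast
  have "arc_at x i \<in> labels K" "arc_at y j \<in> labels K"
    using xy arc_at_in_set_crossing by (auto simp: labels_def)
  then have "arc_at x i = arc_at y j"
    using xy inj_onD[OF assms(2)] by (simp add: arc_at_map_crossing)
  moreover have "(x, i) \<noteq> (y, j)"
    using xy(5) by auto
  ultimately show "odd i \<noteq> odd j"
    using assms(1) xy unfolding opposite_parity_def by blast
qed

text \<open>\<open>fst_rot\<close> says that the band next to either end of \<open>e\<close> belongs
  to another edge; it makes the four arcs leaving the band of \<open>e\<close> distinct.\<close>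

locale negative_edge =
  fixes G :: "'e plane_graph" and e :: 'e
  assumes rot_permutes: "rot G permutes darts G"
    and edge: "e \<in> edges G"
    and weight_e: "weight G e \<le> -2"
    and weight_pos: "\<And>f. f \<in> edges G \<Longrightarrow> f \<noteq> e \<Longrightarrow> 0 < weight G f"
    and fst_rot: "\<And>s. fst (rot G (e, s)) \<noteq> e"
begin

definition bands :: "'e \<Rightarrow> nat" where
  "bands f = nat \<bar>weight G f\<bar>"

definition positive_part :: "(('e \<times> bool) \<times> nat) crossing set" where
  "positive_part = {band_crossing G f k |f k. f \<in> edges G \<and> f \<noteq> e \<and> k < bands f}"

text \<open>The arcs along one side of the band of \<open>e\<close>, numbered from the tail of
  \<open>(e, True)\<close>. The index runs to \<open>bands e\<close> inclusive; 0 and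
  \<open>bands e\<close> give the arcs leaving the band.\<close>

definition left_label :: "nat \<Rightarrow> ('e \<times> bool) \<times> nat" where
  "left_label k = (if k = 0 then (rot G (e, True), 0) else ((e, False), bands e - k))"

definition right_label :: "nat \<Rightarrow> ('e \<times> bool) \<times> nat" where
  "right_label k = (if k < bands e then ((e, True), k) else (rot G (e, False), 0))"

lemma rot_eq_iff: "rot G d = rot G d' \<longleftrightarrow> d = d'"
  using permutes_inj[OF rot_permutes] by (simp add: inj_eq)

lemma band_crossing_e:
  assumes "k < bands e"
  shows "band_crossing G e k =
    Xing (right_label k) (right_label (Suc k)) (left_label (Suc k)) (left_label k)"
  using assms weight_e
  by (auto simp: band_crossing_def Let_def left_arc_def left_label_def right_label_def bands_def rev_dart_def)

lemma half_turn_band_crossing_e: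
  "k < bands e \<Longrightarrow> half_turn (band_crossing G e k) = band left_label right_label k"
  by (simp add: band_crossing_e band_def)

lemma crossings_boundary:
  "crossings (boundary G) = positive_part \<union> band_crossing G e ` {..<bands e}"
  using edge by (auto simp: boundary_def positive_part_def bands_def)

text \<open>A positive crossing is listed as \<open>nl\<close>, \<open>nr\<close>,
  \<open>fr\<close>, \<open>fl\<close>. Seen from \<open>(f, True)\<close> its near left and right
  arcs are at 0 and 1; seen from the reversed dart, which numbers the crossings backwards, they are
  at 2 and 3.\<close>

definition right_pos :: "'e \<times> bool \<Rightarrow> nat \<Rightarrow> (('e \<times> bool) \<times> nat) crossing \<times> nat" where
  "right_pos d j = (if snd d then (band_crossing G (fst d) j, 1)
    else (band_crossing G (fst d) (bands (fst d) - 1 - j), 3))"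

definition left_pos :: "'e \<times> bool \<Rightarrow> nat \<Rightarrow> (('e \<times> bool) \<times> nat) crossing \<times> nat" where
  "left_pos d j = (if snd d then (band_crossing G (fst d) j, 0)
    else (band_crossing G (fst d) (bands (fst d) - 1 - j), 2))"

text \<open>This is the checkerboard pattern of positive bands: right sides sit at odd positions,
  left sides at even ones. The last equation of each case recovers the position from
  \<open>d\<close> and \<open>j\<close>.\<close>

lemma positive_partE:
  assumes "x \<in> positive_part" "i < 4"
  obtains d j where "odd i" "fst d \<in> edges G" "fst d \<noteq> e" "j < bands (fst d)"
      "arc_at x i = (d, j)" "(x, i) = right_pos d j"
  | d j where "even i" "fst d \<in> edges G" "fst d \<noteq> e" "j < bands (fst d)"
      "arc_at x i = left_arc G d j" "(x, i) = left_pos d j"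
proof -
  obtain f k where x: "x = band_crossing G f k" "f \<in> edges G" "f \<noteq> e" "k < bands f"
    using assms(1) by (auto simp: positive_part_def)
  define k' where "k' = bands f - 1 - k"
  have k': "k' < bands f" "bands f - 1 - k' = k" "nat (weight G f) - Suc k = k'"
    using x(4) weight_pos[OF x(2,3)] by (auto simp: k'_def bands_def)
  have X: "x = Xing (left_arc G (f, True) k) ((f, True), k) (left_arc G (f, False) k') ((f, False), k')"
    using weight_pos[OF x(2,3)] by (simp add: x(1) band_crossing_def Let_def rev_dart_def k'(3)[symmetric])
  consider "i = 0" | "i = 1" | "i = 2" | "i = 3"
    using assms(2) by linarith
  then show thesis
  proof cases
    case 1
    then show thesis
      using that(2)[of "(f, True)" k] x by (simp add: X left_pos_def)
  next
    case 2
    then show thesis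
      using that(1)[of "(f, True)" k] x by (simp add: X right_pos_def)
  next
    case 3
    then show thesis
      using that(2)[of "(f, False)" k'] x k' by (simp add: X left_pos_def)
  next
    case 4
    then show thesis
      using that(1)[of "(f, False)" k'] x k' by (simp add: X right_pos_def)
  qed
qed

text \<open>The second component is 0 exactly for \<open>j = 0\<close>, where \<open>rot\<close> is
  injective; otherwise reversal of darts is.\<close>

lemma left_arc_inj:
  assumes "left_arc G d j = left_arc G d' j'" "j < bands (fst d)" "j' < bands (fst d')"
  shows "d = d' \<and> j = j'"
  using assms by (cases d; cases d') (auto simp: left_arc_def rot_eq_iff rev_dart_def bands_def[symmetric] split: if_splits)

text \<open>A label is a right side at no more than one position and a left side at no more than
  one, so equal parity forces equal positions.\<close>

lemma opposite_parity_positive_part: "opposite_parity positive_part"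
  unfolding opposite_parity_def
proof (intro ballI allI impI notI)
  fix x y i j
  assume xy: "x \<in> positive_part" "y \<in> positive_part" "i < 4" "j < 4"
    "arc_at x i = arc_at y j" "(x, i) \<noteq> (y, j)" and par: "odd i = odd j"
  show False
    by (rule positive_partE[OF xy(1,3)]; rule positive_partE[OF xy(2,4)];
        use par xy(5,6) left_arc_inj in \<open>metis prod.inject\<close>)
qed

text \<open>A dart of \<open>e\<close> names right sides only in the band of \<open>e\<close>.
  Elsewhere it can only arise as \<open>rot G d\<close> in the left arc preceding crossing 0 of
  \<open>d\<close>.\<close>

lemma even_at_e:
  assumes "x \<in> positive_part" "i < 4" "arc_at x i = ((e, s), j)"
  shows "even i" "j = 0"
proof -
  have "even i \<and> j = 0"
    by (rule positive_partE[OF assms(1,2)])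
      (use assms(3) in \<open>auto simp: left_arc_def rev_dart_def split: if_splits\<close>)
  then show "even i" "j = 0"
    by auto
qed

text \<open>As the left arc of a dart \<open>d\<close> the label would give
  \<open>d = (e, s)\<close>, because \<open>rot\<close> is injective; the band of \<open>e\<close>
  is excluded.\<close>

lemma odd_at_rot_e:
  assumes "x \<in> positive_part" "i < 4" "arc_at x i = (rot G (e, s), 0)"
  shows "odd i"
  by (rule positive_partE[OF assms(1,2)])
    (use assms(3) in \<open>auto simp: left_arc_def rot_eq_iff bands_def split: if_splits\<close>)

lemma not_in_labels_positive_part:
  assumes "0 < j"
  shows "((e, s), j) \<notin> labels positive_part"
proof
  assume "((e, s), j) \<in> labels positive_part"
  then obtain x i where "x \<in> positive_part" "i < 4" "arc_at x i = ((e, s), j)"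
    unfolding labels_def arc_at_image[symmetric] by auto
  then show False
    using even_at_e(2) assms by blast
qed

lemma band_labels_distinct:
  assumes "i \<le> bands e" "j \<le> bands e"
  shows "left_label i = left_label j \<longleftrightarrow> i = j" "right_label i = right_label j \<longleftrightarrow> i = j"
    "left_label i \<noteq> right_label j"
proof -
  have n: "fst (rot G (e, s)) = e \<longleftrightarrow> False" "rot G (e, s) = (e, s') \<longleftrightarrow> False" "(e, s') = rot G (e, s) \<longleftrightarrow> False"
    for s s'
    using fst_rot[of s] by (metis fst_conv)+
  show "left_label i = left_label j \<longleftrightarrow> i = j" "right_label i = right_label j \<longleftrightarrow> i = j"
    "left_label i \<noteq> right_label j"
    using assms by (auto simp: left_label_def right_label_def n rot_eq_iff)
qed

lemma band_labels_in:
  assumes "i \<le> bands e"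
  shows "left_label i \<in> labels (crossings (boundary G))" "right_label i \<in> labels (crossings (boundary G))"
proof -
  have "0 < bands e"
    using weight_e by (simp add: bands_def)
  then have "i - 1 < bands e" "i = i - 1 \<or> i = Suc (i - 1)"
    using assms by auto
  then obtain k where k: "k < bands e" "i = k \<or> i = Suc k"
    by blast
  then have "left_label i \<in> set_crossing (band_crossing G e k)" "right_label i \<in> set_crossing (band_crossing G e k)"
    by (auto simp: band_crossing_e)
  then show "left_label i \<in> labels (crossings (boundary G))" "right_label i \<in> labels (crossings (boundary G))"
    using k(1) by (auto simp: crossings_boundary labels_def)
qed

text \<open>As the band has at least two crossings, each of them has a dart of \<open>e\<close> at
  position 1 or 3, and a half turn keeps this parity; in \<open>positive_part\<close> such labels
  are at even positions.\<close>

lemma band_not_positive: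
  assumes "k < bands e" "x \<in> positive_part"
  shows "x \<noteq> band_crossing G e k" "x \<noteq> half_turn (band_crossing G e k)"
proof -
  have "2 \<le> bands e"
    using weight_e by (simp add: bands_def)
  then have "(\<exists>s j. right_label (Suc k) = ((e, s), j)) \<or> (\<exists>s j. left_label k = ((e, s), j))"
    using assms(1) by (auto simp: left_label_def right_label_def)
  then show "x \<noteq> band_crossing G e k" "x \<noteq> half_turn (band_crossing G e k)"
    using even_at_e(1)[OF assms(2), of 1] even_at_e(1)[OF assms(2), of 3] assms(1)
    by (auto simp: band_crossing_e)
qed

end

section \<open>From near-alternating graphs to the band of the negative edge\<close>

lemma cas_endpoints:
  "pre_digraph.cas H a p b \<Longrightarrow> p \<noteq> [] \<Longrightarrow> tail H (hd p) = a \<and> head H (last p) = b"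
  by (induction p arbitrary: a) (auto simp: pre_digraph.cas.simps)

text \<open>If \<open>rot\<close> fixed a dart of \<open>e\<close>, no path avoiding
  \<open>e\<close> could reach that endpoint; if it exchanged the dart with its reverse,
  \<open>e\<close> would be a loop.\<close>

lemma near_alternating_graph_negative_edge:
  assumes "near_alternating_graph G e"
  shows "negative_edge G e"
proof
  have conn: "connected_plane_graph G" and loopfree: "loopfree_digraph (underlying G)"
    and nonzero: "\<And>f. f \<in> edges G \<Longrightarrow> weight G f \<noteq> 0"
    and neg: "{f \<in> edges G. weight G f < 0} = {e}" and "\<bar>weight G e\<bar> \<ge> 2"
    and card: "card (paths_without G e) > 2"
    using assms by (auto simp: near_alternating_graph_def Let_def)
  show perm: "rot G permutes darts G"
    using conn by (simp add: connected_plane_graph_def)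
  have e: "e \<in> edges G" "weight G e < 0"
    using neg by auto
  then show "e \<in> edges G" "weight G e \<le> -2"
    using \<open>\<bar>weight G e\<bar> \<ge> 2\<close> by auto
  show "0 < weight G f" if "f \<in> edges G" "f \<noteq> e" for f
    using that neg nonzero[of f] by (metis (mono_tags, lifting) linorder_less_linear mem_Collect_eq singletonD)
  have dart: "(e, s) \<in> arcs (underlying G)" for s
    using e by (simp add: underlying_def darts_def)
  have ends: "orbit (rot G) (e, True) \<noteq> orbit (rot G) (e, False)"
    using loopfree_digraph.no_loops[OF loopfree dart[of True]] by (simp add: underlying_def rev_dart_def)
  have fin: "finite (darts G)"
    using conn by (simp add: connected_plane_graph_def darts_def)
  then have perm': "permutation (rot G)"
    using perm unfolding permutation_permutes by blast
  note self = permutation_self_in_orbit[OF perm']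
  obtain p where "p \<in> paths_without G e"
    using card by (metis all_not_in_conv card.empty not_less_zero)
  then have cas: "pre_digraph.cas (underlying_without G e) (orbit (rot G) (e, True)) p (orbit (rot G) (e, False))"
    and arcs: "set p \<subseteq> darts G - {(e, True), (e, False)}"
    by (auto simp: paths_without_def pre_digraph.apath_def pre_digraph.awalk_def underlying_without_def
        underlying_def pre_digraph.del_arc_def rev_dart_def)
  have "p \<noteq> []"
    using cas ends by (auto simp: pre_digraph.cas.simps)
  \<comment> \<open>The first dart of the path and the reverse of the last one are darts of other
    edges at the two endpoints of \<open>e\<close>.\<close>
  then have "orbit (rot G) (hd p) = orbit (rot G) (e, True)"
    "orbit (rot G) (rev_dart (last p)) = orbit (rot G) (e, False)"
    "fst (hd p) \<noteq> e" "fst (rev_dart (last p)) \<noteq> e"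
    using cas_endpoints[OF cas] arcs hd_in_set[of p] last_in_set[of p]
    by (cases "hd p"; cases "last p";
        auto simp: underlying_without_def underlying_def pre_digraph.del_arc_def rev_dart_def)+
  then have other: "\<exists>d. d \<in> orbit (rot G) (e, s) \<and> fst d \<noteq> e" for s
    using self by (cases s) metis+
  show "fst (rot G (e, s)) \<noteq> e" for s
  proof
    assume "fst (rot G (e, s)) = e"
    then consider "rot G (e, s) = (e, s)" | "rot G (e, s) = (e, \<not> s)"
      by (cases "rot G (e, s)") auto
    then show False
    proof cases
      case 1
      have "d = (e, s)" if "d \<in> orbit (rot G) (e, s)" for d
        using that by (induction rule: orbit.induct) (use 1 in simp_all)
      then show False
        using other[of s] by auto
    next
      case 2
      then have "(e, \<not> s) \<in> orbit (rot G) (e, s)"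
        using orbit.base[of "rot G" "(e, s)"] by simp
      then have "orbit (rot G) (e, \<not> s) = orbit (rot G) (e, s)"
        using orbit_cyclic_eq3 cyclic_on_orbit[OF perm fin] by metis
      then show False
        using ends by (cases s) auto
    qed
  qed
qed

text \<open>\<open>D\<close> agrees with \<open>boundary G\<close> only up to labels and half turns.
  A further isomorphism lists the band of \<open>e\<close> as in \<open>band\<close>, with the
  renamed positive crossings as \<open>K\<close>; then the untwisting applies.\<close>

lemma (in negative_edge) almost_alternating_equivalent:
  fixes D :: "nat diagram"
  assumes D: "link_diagram D" and iso: "diagram_iso (boundary G) D"
  shows "\<exists>D'. equivclp diagram_step D D' \<and> almost_alternating D'"
proof -
  obtain f g where f: "inj_on f (labels (crossings (boundary G)))"
    and g: "bij_betw g (crossings (boundary G)) (crossings D)"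
    and fg: "\<And>x. x \<in> crossings (boundary G) \<Longrightarrow> g x = map_crossing f x \<or> g x = half_turn (map_crossing f x)"
    using iso unfolding diagram_iso_def by blast
  obtain m where bands_e: "bands e = Suc m" "0 < m"
  proof
    show "bands e = Suc (bands e - 1)" "0 < bands e - 1"
      using weight_e by (auto simp: bands_def)
  qed
  let ?B = "crossings (boundary G)"
  define K where "K = map_crossing f ` positive_part"
  define L0 R0 where "L0 = f \<circ> left_label" and "R0 = f \<circ> right_label"
  \<comment> \<open>The half turn is applied exactly to the crossings of the band of
    \<open>e\<close>, whatever representatives \<open>g\<close> has chosen.\<close>
  define h where "h x = (if x \<in> positive_part then map_crossing f x else half_turn (map_crossing f x))" for x
  define D0 where "D0 = \<lparr>crossings = band L0 R0 ` {..<Suc m} \<union> K, circles = circles D\<rparr>"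
  have hB: "h ` ?B = crossings D0"
  proof -
    have "h ` positive_part = K"
      by (auto simp: h_def K_def)
    moreover have "h (band_crossing G e k) = band L0 R0 k" if "k < bands e" for k
      using band_not_positive(1)[OF that] half_turn_band_crossing_e[OF that]
      by (auto simp: h_def half_turn_map_crossing band_def L0_def R0_def)
    ultimately show ?thesis
      unfolding D0_def crossings_boundary bands_e(1)[symmetric] by (auto simp: image_Un image_image)
  qed
  have inj_h: "inj_on h ?B"
  proof (rule inj_onI)
    fix x y assume xy: "x \<in> ?B" "y \<in> ?B" "h x = h y"
    define x' y' where "x' = (if x \<in> positive_part then x else half_turn x)"
      and "y' = (if y \<in> positive_part then y else half_turn y)"
    have "map_crossing f x' = map_crossing f y'"
      using xy(3) by (auto simp: h_def x'_def y'_def half_turn_map_crossing split: if_splits)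
    moreover have "set_crossing x' \<subseteq> labels ?B" "set_crossing y' \<subseteq> labels ?B"
      using xy(1,2) by (auto simp: labels_def x'_def y'_def)
    ultimately have "x' = y'"
      using map_crossing_inj_on[OF f] by blast
    then show "x = y"
      using xy(1,2) band_not_positive unfolding x'_def y'_def crossings_boundary
      by (auto split: if_splits) (metis half_turn_half_turn)+
  qed
  define g' where "g' = h \<circ> inv_into ?B g"
  have g': "bij_betw g' (crossings D) (crossings D0)"
    unfolding g'_def
    by (rule bij_betw_trans[OF bij_betw_inv_into[OF g]]) (simp add: bij_betw_def inj_h hB)
  have g'_half: "g' y = y \<or> g' y = half_turn y" if y: "y \<in> crossings D" for y
  proof -
    obtain x where x: "x \<in> ?B" "y = g x"
      using g y by (auto simp: bij_betw_def)
    then have "g' y = h x"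
      using g by (simp add: g'_def bij_betw_def)
    then show ?thesis
      using fg[OF x(1)] x(2) by (auto simp: h_def)
  qed
  have D0: "link_diagram D0"
    using D g' g'_half by (rule link_diagram_half_turns)
  have "diagram_iso D D0"
    unfolding diagram_iso_def
  proof (intro conjI exI)
    show "circles D = circles D0"
      by (simp add: D0_def)
    show "bij_betw g' (crossings D) (crossings D0)"
      by (rule g')
    show "\<forall>x\<in>crossings D. g' x = map_crossing id x \<or> g' x = half_turn (map_crossing id x)"
      using g'_half by (simp add: crossing.map_id)
  qed simp
  then have step: "diagram_step D D0"
    using D D0 by (simp add: diagram_step_def)
  have "finite (labels ?B)"
  proof -
    have "finite ?B"
      using g D bij_betw_finite unfolding link_diagram_def by blast
    then have "finite (arc_of ` ends (boundary G))"
      by (simp add: finite_ends)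
    then show ?thesis
      by (simp add: labels_eq_arc_of)
  qed
  then have fin: "finite (f ` labels ?B)"
    by simp
  obtain a where a: "a \<notin> f ` labels ?B"
    using ex_new_if_finite[OF infinite_UNIV_nat fin] by blast
  obtain b where b: "b \<notin> insert a (f ` labels ?B)"
    using ex_new_if_finite[OF infinite_UNIV_nat, of "insert a (f ` labels ?B)"] fin by blast
  have LR0: "L0 i \<in> f ` labels ?B" "R0 i \<in> f ` labels ?B" if "i \<le> Suc m" for i
    using band_labels_in[of i] that bands_e(1) by (auto simp: L0_def R0_def)
  have LR0_eq: "L0 i = L0 j \<longleftrightarrow> i = j" "R0 i = R0 j \<longleftrightarrow> i = j" "L0 i \<noteq> R0 j" if "i \<le> Suc m" "j \<le> Suc m" for i j
    using band_labels_distinct[of i j] band_labels_in[of i] band_labels_in[of j] that bands_e(1) inj_on_eq_iff[OF f]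
    by (auto simp: L0_def R0_def)
  have fresh: "L0 i \<noteq> a" "L0 i \<noteq> b" "R0 i \<noteq> a" "R0 i \<noteq> b" "a \<noteq> L0 i" "b \<noteq> L0 i" "a \<noteq> R0 i" "b \<noteq> R0 i"
    if "i \<le> Suc m" for i
    using LR0[OF that] a b by auto
  have posB: "labels positive_part \<subseteq> labels ?B"
    by (auto simp: crossings_boundary labels_def)
  have K_labels: "labels K = f ` labels positive_part"
    by (auto simp: K_def labels_def crossing.set_map)
  have K0: "f l \<notin> labels K" if "l \<in> labels ?B" "l \<notin> labels positive_part" for l
    using that posB inj_on_image_mem_iff[OF f] unfolding K_labels by blast
  \<comment> \<open>Between two crossings of the band the labels are darts of \<open>e\<close> with
    positive index, which no positive band uses.\<close>
  have K1: "L0 i \<notin> labels K" "R0 i \<notin> labels K" if "0 < i" "i \<le> m" for i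
    using that bands_e band_labels_in[of i] K0[of "left_label i"] K0[of "right_label i"]
      not_in_labels_positive_part[of "Suc m - i" False] not_in_labels_positive_part[of i True]
    by (auto simp: L0_def R0_def left_label_def right_label_def)
  have K2: "a \<notin> labels K" "b \<notin> labels K"
    using a b posB unfolding K_labels by auto
  have eqs: "R0 j \<noteq> L0 i" if "i \<le> Suc m" "j \<le> Suc m" for i j
    using LR0_eq(3)[OF that] by simp
  \<comment> \<open>The curl cuts the arc \<open>L0 m\<close>: the piece at the last crossing keeps
    its label as \<open>?u\<close>, the piece at the crossing before gets \<open>b\<close>, and the
    loop gets \<open>a\<close>.\<close>
  let ?L = "L0(m := b)" and ?R = "R0(Suc m := a)" and ?u = "L0 m" and ?v = "R0 (Suc m)"
  interpret twisted_band K ?L ?R ?u ?v m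
    by unfold_locales (use bands_e(2) b K1 K2 in \<open>auto simp: LR0_eq eqs fresh\<close>)
  have "?L(m := ?u) = L0" "?R(Suc m := ?v) = R0"
    by auto
  then have D0': "D0 = \<lparr>crossings = band (?L(m := ?u)) (?R(Suc m := ?v)) ` {..<Suc m} \<union> K, circles = circles D\<rparr>"
    by (simp add: D0_def)
  let ?D = "\<lparr>crossings = untwisting ?L ?R ?u ?v m 0 \<union> K, circles = circles D\<rparr>"
  have D1: "link_diagram ?D" and steps: "equivclp diagram_step D0 ?D"
    using untwist_band[of "circles D"] D0 unfolding D0' by blast+
  have at: "arc_at x i = l" if "x \<in> positive_part" "i < 4" "arc_at (map_crossing f x) i = f l" "l \<in> labels ?B" for x i l
  proof -
    have "arc_at x i \<in> labels ?B"
      using that(1) arc_at_in_set_crossing[OF that(2)] posB by (auto simp: labels_def)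
    then show ?thesis
      using that inj_onD[OF f] by (simp add: arc_at_map_crossing)
  qed
  have "almost_alternating ?D"
  proof (rule almost_alternating_untwisted[OF D1])
    show "opposite_parity K"
      unfolding K_def using opposite_parity_positive_part inj_on_subset[OF f posB]
      by (rule opposite_parity_map)
    fix y and i :: nat
    assume y: "y \<in> K" "i < 4"
    obtain x where x: "x \<in> positive_part" "y = map_crossing f x"
      using y(1) by (auto simp: K_def)
    have lab: "left_label 0 \<in> labels ?B" "right_label (Suc m) \<in> labels ?B"
      "left_label (Suc m) \<in> labels ?B" "right_label 0 \<in> labels ?B"
      using band_labels_in[of 0] band_labels_in[of "Suc m"] bands_e(1) by auto
    \<comment> \<open>These two arcs are right sides of the bands that follow \<open>e\<close> in
      the rotation at its endpoints; \<open>?R 0\<close> and \<open>?L (Suc m)\<close> are darts of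
      \<open>e\<close> with index 0, hence left sides of other bands.\<close>
    show "odd i" if "arc_at y i \<in> {?L 0, ?v}"
    proof -
      have "arc_at x i = left_label 0 \<or> arc_at x i = right_label (Suc m)"
        using that bands_e(2) at[OF x(1) y(2), of "left_label 0"]
          at[OF x(1) y(2), of "right_label (Suc m)"] lab by (auto simp: L0_def R0_def x(2))
      then show ?thesis
        using odd_at_rot_e[OF x(1) y(2)] bands_e(1) by (auto simp: left_label_def right_label_def)
    qed
    show "even i" if "arc_at y i \<in> {?R 0, ?L (Suc m)}"
    proof -
      have "arc_at x i = right_label 0 \<or> arc_at x i = left_label (Suc m)"
        using that bands_e(2) at[OF x(1) y(2), of "right_label 0"]
          at[OF x(1) y(2), of "left_label (Suc m)"] lab by (auto simp: L0_def R0_def x(2))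
      then show ?thesis
        using even_at_e(1)[OF x(1) y(2)] bands_e(1) by (auto simp: left_label_def right_label_def)
    qed
  qed
  moreover have "equivclp diagram_step D ?D"
    using step steps by (meson converse_r_into_equivclp equivclp_trans r_into_equivclp)
  ultimately show ?thesis
    by blast
qed

theorem lemma1p8:
  fixes L :: "nat diagram set"
  assumes "near_alternating_link L"
  shows "almost_alternating_link L"
proof -
  obtain D where L: "L \<in> links" "D \<in> L" "near_alternating D"
    using assms unfolding near_alternating_link_def by blast
  then obtain G :: "nat plane_graph" and e
    where D: "link_diagram D" "near_alternating_graph G e" "diagram_iso (boundary G) D"
    unfolding near_alternating_def by blast
  then interpret negative_edge G e
    by (intro near_alternating_graph_negative_edge)
  obtain D' where D': "equivclp diagram_step D D'" "almost_alternating D'"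
    using almost_alternating_equivalent D by blast
  obtain E where E: "L = same_link `` {E}"
    using L(1) by (auto simp: links_def quotient_def)
  have "D' \<in> L"
    using L(2) D'(1) equivclp_trans unfolding E same_link_def by fastforce
  then show ?thesis
    using L(1) D'(2) unfolding almost_alternating_link_def by blast
qed

end
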